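(* Let $X$ be a geodesic metric space that is hyperbolic relative to a collection $\mathcal{P}$ of uniformly coarsely connected subsets, and fix a model of the coned-off space $\hat X$. Then there exists $K$ so that if $\gamma$ is a geodesic in $\hat X$ with endpoints in $X$, then substituting each $\mathcal{P}$-component of $\gamma$ with a geodesic in $X$ with the same endpoints, one gets a $(K,K)$-quasi-geodesic in $X$.
   Context: **General.** $(X,d)$ is a geodesic metric space, $\mathcal{P}$ a collection of subsets. $N_K(A)=\{x: d(x,A)\le K\}$. An almost-geodesic is a continuous quasi-geodesic. $\mathcal{P}$ is uniformly coarsely connected if there is $K$ such that for each $P\in\mathcal{P}$ any $x,y\in P$ are joined by a chain $x=x_0,\dots,x_n=y$ in $P$ with $d(x_i,x_{i+1})\le K$. **Relative hyperbolicity.** $(\alpha_1)$: for each $K$ there is $B$ with $diam(N_K(P)\cap N_K(Q))\le B$ for all distinct $P,Q\in\mathcal{P}$. $(\alpha_2)$: there are $\epsilon\in(0,1/2)$, $M\ge0$ such that for each $P\in\mathcal{P}$ and $x,y\in N_{\epsilon d(x,y)}(P)$, any geodesic from $x$ to $y$ intersects $N_M(P)$. $X$ is $( * )$-asymptotically tree-graded with respect to $\mathcal{P}$ if for every $C\ge0$ there are $\sigma,\delta$ such that every triangle with $(1,C)$-almost-geodesic sides $\gamma_1,\gamma_2,\gamma_3$ satisfies either (C) some ball of radius $\sigma$ intersects all sides, or (P) there is $P\in\mathcal{P}$ such that $N_\sigma(P)$ intersects all sides and the entrance points $x_i$ and exit points $y_i$ of $\gamma_i$ in/from $N_\sigma(P)$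 satisfy $d(y_i,x_{i+1})\le\delta$ (indices mod 3, sides oriented cyclically). $X$ is hyperbolic relative to $\mathcal{P}$ if $(\alpha_1)$, $(\alpha_2)$ hold and $X$ is $( * )$-asymptotically tree-graded with respect to $\mathcal{P}$. **Coned-off spaces.** A maximal $k$-net is a maximal collection of distinct points at mutual distance at least $k$. Fix maximal $k$-nets $N_P$ in each $P\in\mathcal{P}$ ($k$ common to all $P$). The coned-off space $\hat X$ is obtained from $X$ by adding segments $e_{x,y}$ of length $1$, called $P$-components (or $\mathcal{P}$-components), joining all pairs of distinct points $x,y\in N_P$, for all $P\in\mathcal{P}$, with the path metric. *)

theory Defs
  imports "HOL-Analysis.Analysis"
begin

section \<open>Geodesics and quasi-geodesics\<close>

text \<open>Paths are given by a length \<open>L\<close> and a function whose values matter only on \<open>{0..L}\<close>.\<close>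

definition geodesic_path :: "'b set \<Rightarrow> ('b \<Rightarrow> 'b \<Rightarrow> real) \<Rightarrow> real \<Rightarrow> (real \<Rightarrow> 'b) \<Rightarrow> bool" where
  "geodesic_path M d L \<gamma> \<longleftrightarrow> 0 \<le> L \<and> \<gamma> ` {0..L} \<subseteq> M \<and>
     (\<forall>s\<in>{0..L}. \<forall>t\<in>{0..L}. d (\<gamma> s) (\<gamma> t) = \<bar>s - t\<bar>)"

definition geodesic_from_to ::
  "'b set \<Rightarrow> ('b \<Rightarrow> 'b \<Rightarrow> real) \<Rightarrow> 'b \<Rightarrow> 'b \<Rightarrow> real \<Rightarrow> (real \<Rightarrow> 'b) \<Rightarrow> bool" where
  "geodesic_from_to M d x y L \<gamma> \<longleftrightarrow> geodesic_path M d L \<gamma> \<and> \<gamma> 0 = x \<and> \<gamma> L = y"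

definition geodesic_space :: "'b set \<Rightarrow> ('b \<Rightarrow> 'b \<Rightarrow> real) \<Rightarrow> bool" where
  "geodesic_space M d \<longleftrightarrow> (\<forall>x\<in>M. \<forall>y\<in>M. \<exists>L \<gamma>. geodesic_from_to M d x y L \<gamma>)"

definition quasi_geodesic :: "real \<Rightarrow> real \<Rightarrow> real \<Rightarrow> (real \<Rightarrow> 'a::metric_space) \<Rightarrow> bool" where
  "quasi_geodesic K C L \<gamma> \<longleftrightarrow> 1 \<le> K \<and> 0 \<le> C \<and> 0 \<le> L \<and>
     (\<forall>s\<in>{0..L}. \<forall>t\<in>{0..L}.
        \<bar>s - t\<bar> / K - C \<le> dist (\<gamma> s) (\<gamma> t) \<and> dist (\<gamma> s) (\<gamma> t) \<le> K * \<bar>s - t\<bar> + C)"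

definition almost_geodesic :: "real \<Rightarrow> real \<Rightarrow> real \<Rightarrow> (real \<Rightarrow> 'a::metric_space) \<Rightarrow> bool" where
  "almost_geodesic K C L \<gamma> \<longleftrightarrow> quasi_geodesic K C L \<gamma> \<and> continuous_on {0..L} \<gamma>"

section \<open>Relative hyperbolicity\<close>

text \<open>Since \<^term>\<open>infdist x {} = 0\<close>, the empty set is excluded explicitly: its neighbourhoods
  are empty.\<close>

definition nbhd :: "real \<Rightarrow> 'a::metric_space set \<Rightarrow> 'a set" where
  "nbhd K A = {x. A \<noteq> {} \<and> infdist x A \<le> K}"

definition uniformly_coarsely_connected :: "'a::metric_space set set \<Rightarrow> bool" where
  "uniformly_coarsely_connected \<P> \<longleftrightarrow>
     (\<exists>K. \<forall>P\<in>\<P>. \<forall>x\<in>P. \<forall>y\<in>P. \<exists>(n::nat) c. c 0 = x \<and> c n = y \<and>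
        (\<forall>i\<le>n. c i \<in> P) \<and> (\<forall>i<n. dist (c i) (c (Suc i)) \<le> K))"

text \<open>The diameter bound is written pointwise because \<^const>\<open>diameter\<close> is unspecified on
  unbounded sets.\<close>

definition alpha1 :: "'a::metric_space set set \<Rightarrow> bool" where
  "alpha1 \<P> \<longleftrightarrow> (\<forall>K. \<exists>B. \<forall>P\<in>\<P>. \<forall>Q\<in>\<P>. P \<noteq> Q \<longrightarrow>
     (\<forall>x \<in> nbhd K P \<inter> nbhd K Q. \<forall>y \<in> nbhd K P \<inter> nbhd K Q. dist x y \<le> B))"

definition alpha2 :: "'a::metric_space set set \<Rightarrow> bool" where
  "alpha2 \<P> \<longleftrightarrow> (\<exists>\<epsilon> M. 0 < \<epsilon> \<and> \<epsilon> < 1/2 \<and> 0 \<le> M \<and>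
     (\<forall>P\<in>\<P>. \<forall>x y. x \<in> nbhd (\<epsilon> * dist x y) P \<longrightarrow> y \<in> nbhd (\<epsilon> * dist x y) P \<longrightarrow>
        (\<forall>L \<gamma>. geodesic_from_to UNIV dist x y L \<gamma> \<longrightarrow> \<gamma> ` {0..L} \<inter> nbhd M P \<noteq> {})))"

text \<open>First and last point of a path in a set. They are only used for a continuous path
  meeting a closed set, where the infimum and supremum are attained.\<close>

definition entrance_point :: "real \<Rightarrow> (real \<Rightarrow> 'a) \<Rightarrow> 'a set \<Rightarrow> 'a" where
  "entrance_point L \<gamma> A = \<gamma> (Inf {t\<in>{0..L}. \<gamma> t \<in> A})"

definition exit_point :: "real \<Rightarrow> (real \<Rightarrow> 'a) \<Rightarrow> 'a set \<Rightarrow> 'a" where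
  "exit_point L \<gamma> A = \<gamma> (Sup {t\<in>{0..L}. \<gamma> t \<in> A})"

text \<open>Triangles: side \<open>i\<close> (for \<open>i < 3\<close>) is \<open>\<gamma> i\<close>, defined on \<open>{0..L i}\<close>.\<close>

definition almost_geodesic_triangle ::
  "real \<Rightarrow> (nat \<Rightarrow> real) \<Rightarrow> (nat \<Rightarrow> real \<Rightarrow> 'a::metric_space) \<Rightarrow> bool" where
  "almost_geodesic_triangle C L \<gamma> \<longleftrightarrow>
     (\<forall>i<3. almost_geodesic 1 C (L i) (\<gamma> i) \<and> \<gamma> i (L i) = \<gamma> (Suc i mod 3) 0)"

definition triangle_cond_C ::
  "real \<Rightarrow> (nat \<Rightarrow> real) \<Rightarrow> (nat \<Rightarrow> real \<Rightarrow> 'a::metric_space) \<Rightarrow> bool" where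
  "triangle_cond_C \<sigma> L \<gamma> \<longleftrightarrow> (\<exists>z. \<forall>i<3. \<gamma> i ` {0..L i} \<inter> cball z \<sigma> \<noteq> {})"

definition triangle_cond_P ::
  "'a::metric_space set set \<Rightarrow> real \<Rightarrow> real \<Rightarrow> (nat \<Rightarrow> real) \<Rightarrow> (nat \<Rightarrow> real \<Rightarrow> 'a) \<Rightarrow> bool" where
  "triangle_cond_P \<P> \<sigma> \<delta> L \<gamma> \<longleftrightarrow> (\<exists>P\<in>\<P>.
     (\<forall>i<3. \<gamma> i ` {0..L i} \<inter> nbhd \<sigma> P \<noteq> {}) \<and>
     (\<forall>i<3. dist (exit_point (L i) (\<gamma> i) (nbhd \<sigma> P))
                 (entrance_point (L (Suc i mod 3)) (\<gamma> (Suc i mod 3)) (nbhd \<sigma> P)) \<le> \<delta>))"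

definition star_asymp_tree_graded :: "'a::metric_space set set \<Rightarrow> bool" where
  "star_asymp_tree_graded \<P> \<longleftrightarrow> (\<forall>C\<ge>0. \<exists>\<sigma> \<delta>. \<forall>L \<gamma>.
     almost_geodesic_triangle C L \<gamma> \<longrightarrow> triangle_cond_C \<sigma> L \<gamma> \<or> triangle_cond_P \<P> \<sigma> \<delta> L \<gamma>)"

definition relatively_hyperbolic :: "'a::metric_space set set \<Rightarrow> bool" where
  "relatively_hyperbolic \<P> \<longleftrightarrow> alpha1 \<P> \<and> alpha2 \<P> \<and> star_asymp_tree_graded \<P>"

section \<open>The coned-off space\<close>

definition maximal_net :: "real \<Rightarrow> 'a::metric_space set \<Rightarrow> 'a set \<Rightarrow> bool" where
  "maximal_net k P A \<longleftrightarrow> A \<subseteq> P \<and> pairwise (\<lambda>x y. k \<le> dist x y) A \<and>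
     (\<forall>A'. A \<subseteq> A' \<and> A' \<subseteq> P \<and> pairwise (\<lambda>x y. k \<le> dist x y) A' \<longrightarrow> A' = A)"

text \<open>A point of the coned-off space is a point of \<open>X\<close>, or an interior point of one of the added
  segments, given by the set \<open>P\<close> the segment belongs to and by its barycentric coordinates with
  respect to the two endpoints. Thus a segment is attached to an unordered pair, while distinct
  members of the collection give distinct segments even if they share both endpoints.\<close>

datatype 'a cone_point = Base 'a | Inner "'a set" "'a \<Rightarrow> real"

definition edge_point :: "'a set \<Rightarrow> 'a \<Rightarrow> 'a \<Rightarrow> real \<Rightarrow> 'a cone_point" where
  "edge_point P x y t =
     (if t = 0 then Base x else if t = 1 then Base y
      else Inner P (\<lambda>z. if z = x then 1 - t else if z = y then t else 0))"

definition is_edge :: "'a set set \<Rightarrow> ('a set \<Rightarrow> 'a set) \<Rightarrow> 'a set \<Rightarrow> 'a \<Rightarrow> 'a \<Rightarrow> bool" where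
  "is_edge \<P> N P x y \<longleftrightarrow> P \<in> \<P> \<and> x \<in> N P \<and> y \<in> N P \<and> x \<noteq> y"

definition coned_off :: "'a set set \<Rightarrow> ('a set \<Rightarrow> 'a set) \<Rightarrow> 'a cone_point set" where
  "coned_off \<P> N = range Base \<union> {edge_point P x y t |P x y t. is_edge \<P> N P x y \<and> t \<in> {0..1}}"

text \<open>Lengths of paths that are finite concatenations of geodesics of \<open>X\<close> (a step from \<open>x\<close> to \<open>y\<close>
  has length \<open>dist x y\<close>) and of subsegments of the added unit segments. As \<open>X\<close> is geodesic, their
  infimum is the path metric.\<close>

inductive coned_path_length ::
  "'a::metric_space set set \<Rightarrow> ('a set \<Rightarrow> 'a set) \<Rightarrow> 'a cone_point \<Rightarrow> 'a cone_point \<Rightarrow> real \<Rightarrow> bool"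
  for \<P> N where
  refl: "p \<in> coned_off \<P> N \<Longrightarrow> coned_path_length \<P> N p p 0"
| base: "coned_path_length \<P> N (Base y) q l \<Longrightarrow>
         coned_path_length \<P> N (Base x) q (dist x y + l)"
| edge: "is_edge \<P> N P x y \<Longrightarrow> s \<in> {0..1} \<Longrightarrow> t \<in> {0..1} \<Longrightarrow>
         coned_path_length \<P> N (edge_point P x y t) q l \<Longrightarrow>
         coned_path_length \<P> N (edge_point P x y s) q (\<bar>s - t\<bar> + l)"

definition coned_dist ::
  "'a::metric_space set set \<Rightarrow> ('a set \<Rightarrow> 'a set) \<Rightarrow> 'a cone_point \<Rightarrow> 'a cone_point \<Rightarrow> real" where
  "coned_dist \<P> N p q = Inf {l. coned_path_length \<P> N p q l}"

section \<open>Substituting the components of a geodesic\<close>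

text \<open>Starting times of the components of a path. A geodesic of the coned-off space with endpoints
  in \<open>X\<close> that meets the interior of an added segment traverses the whole segment at unit speed, so
  its components are its restrictions to \<open>{s..s+1}\<close> for \<open>s\<close> in this set.\<close>

definition component_starts ::
  "'a set set \<Rightarrow> ('a set \<Rightarrow> 'a set) \<Rightarrow> real \<Rightarrow> (real \<Rightarrow> 'a cone_point) \<Rightarrow> real set" where
  "component_starts \<P> N L \<gamma> = {s. 0 \<le> s \<and> s + 1 \<le> L \<and>
     (\<exists>P x y. is_edge \<P> N P x y \<and> (\<forall>r\<in>{0..1}. \<gamma> (s + r) = edge_point P x y r))}"

text \<open>\<open>\<eta>\<close>, on \<open>{0..L'}\<close>, arises from \<open>\<gamma>\<close>, on \<open>{0..L}\<close>, by replacing the component starting at each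
  time \<open>s\<close> with a geodesic \<open>\<alpha> s\<close> of \<open>X\<close> of length \<open>len s\<close> with the same endpoints. As each
  replacement changes the length by \<open>len s - 1\<close>, time \<open>t\<close> outside the open components is shifted to
  \<open>\<tau> t\<close>. The set of starting times is finite, since two of them differ by at least \<open>1\<close>.\<close>

definition component_substitution ::
  "'a::metric_space set set \<Rightarrow> ('a set \<Rightarrow> 'a set) \<Rightarrow> real \<Rightarrow> (real \<Rightarrow> 'a cone_point) \<Rightarrow>
     real \<Rightarrow> (real \<Rightarrow> 'a) \<Rightarrow> bool" where
  "component_substitution \<P> N L \<gamma> L' \<eta> \<longleftrightarrow> (\<exists>len \<alpha>.
     let S = component_starts \<P> N L \<gamma>;
         \<tau> = (\<lambda>t. t + (\<Sum>s | s \<in> S \<and> s + 1 \<le> t. len s - 1))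
     in (\<forall>s\<in>S. geodesic_path UNIV dist (len s) (\<alpha> s) \<and>
               Base (\<alpha> s 0) = \<gamma> s \<and> Base (\<alpha> s (len s)) = \<gamma> (s + 1)) \<and>
        L' = \<tau> L \<and>
        (\<forall>t\<in>{0..L}. (\<forall>s\<in>S. t \<notin> {s<..<s + 1}) \<longrightarrow> Base (\<eta> (\<tau> t)) = \<gamma> t) \<and>
        (\<forall>s\<in>S. \<forall>r\<in>{0..len s}. \<eta> (\<tau> s + r) = \<alpha> s r))"

end

theory Submission
  imports Defs "HOL-Real_Asymp.Real_Asymp"
begin

text \<open>Since peripheral sets have bounded diameter in the coned-off space, the triangle condition
  makes triangles of geodesics of \<open>X\<close> thin for the coned metric. By the usual argument with
  logarithmic bounds for paths, a geodesic of \<open>X\<close> then stays, in the coned metric, close to a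
  coned-off geodesic \<open>\<gamma>\<close> with the same endpoints.

  Let \<open>\<gamma>\<close> start at \<open>x\<close> and traverse a component in \<open>P\<close> from \<open>p\<close> to \<open>q\<close>. The projection of \<open>x\<close> to \<open>P\<close> is
  close to \<open>p\<close>: if \<open>z\<close> lies on \<open>\<gamma>\<close> at a large fixed coned distance before \<open>p\<close>, a geodesic of \<open>X\<close> from
  \<open>x\<close> to \<open>z\<close> stays close to \<open>\<gamma>\<close> before \<open>z\<close>, hence away from \<open>P\<close>, so \<open>x\<close> and \<open>z\<close> have nearby
  projections; and from \<open>z\<close> to \<open>p\<close> the projection moves by a bounded amount, as \<open>\<gamma>\<close> uses no other
  edge of \<open>P\<close>. Therefore \<open>d(x, q)\<close> is at least \<open>d(x, p) + d(p, q)\<close> up to a constant. Summing this along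
  \<open>\<gamma>\<close>, the total error is linear in the length of \<open>\<gamma>\<close>, which is at most the distance in \<open>X\<close>.\<close>

section \<open>Projections to peripheral sets\<close>

text \<open>The curve \<gamma> leaves X along the added segments, while the tree-graded condition
  concerns X only. Therefore \<gamma> enters through its base points alone, discretised into chains
  whose steps are short moves in X or jumps inside a net, and thinness is established only for
  geodesics of X, with distances measured in the coned metric. Two facts make the discretisation
  faithful: a coned distance below \<open>1\<close> between base points is a distance in X, and
  \<gamma> crosses completely every segment that it enters. The gain along a component is wanted on
  both of its sides, because a point of the substituted path may lie in the middle of a substituted
  geodesic; the second side comes from reversing \<gamma>.\<close>

abbreviation geod :: "'a::metric_space \<Rightarrow> 'a \<Rightarrow> real \<Rightarrow> (real \<Rightarrow> 'a) \<Rightarrow> bool" where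
  "geod \<equiv> geodesic_from_to UNIV dist"

lemma geodD:
  assumes "geod x y L g"
  shows "0 \<le> L" "g 0 = x" "g L = y" "dist x y = L"
    "\<And>s t. s \<in> {0..L} \<Longrightarrow> t \<in> {0..L} \<Longrightarrow> dist (g s) (g t) = \<bar>s - t\<bar>"
    "\<And>t. t \<in> {0..L} \<Longrightarrow> dist x (g t) = t"
    "\<And>t. t \<in> {0..L} \<Longrightarrow> dist (g t) y = L - t"
proof -
  show L: "0 \<le> L" and g0: "g 0 = x" and gL: "g L = y"
    using assms by (auto simp: geodesic_from_to_def geodesic_path_def)
  show *: "dist (g s) (g t) = \<bar>s - t\<bar>" if "s \<in> {0..L}" "t \<in> {0..L}" for s t
    using assms that unfolding geodesic_from_to_def geodesic_path_def by blast
  show "dist x y = L" using *[of 0 L] L g0 gL by simp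
  show "dist x (g t) = t" if "t \<in> {0..L}" for t using *[of 0 t] that g0 by simp
  show "dist (g t) y = L - t" if "t \<in> {0..L}" for t using *[of t L] that gL by simp
qed

lemma geod_sub:
  assumes "geod x y L g" "0 \<le> a" "a \<le> b" "b \<le> L"
  shows "geod (g a) (g b) (b - a) (\<lambda>t. g (a + t))"
  using assms geodD(5)[OF assms(1)] unfolding geodesic_from_to_def geodesic_path_def by auto

lemma geod_rev:
  assumes "geod x y L g"
  shows "geod y x L (\<lambda>t. g (L - t))"
  using assms geodD(5)[OF assms(1)] unfolding geodesic_from_to_def geodesic_path_def by auto

lemma geod_continuous:
  assumes "geod x y L g"
  shows "continuous_on {0..L} g"
proof -
  have "1-lipschitz_on {0..L} g"
    by (rule lipschitz_onI) (auto simp: geodD(5)[OF assms] dist_real_def)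
  then show ?thesis by (rule lipschitz_on_continuous_on)
qed

lemma nbhd_mono: "x \<in> nbhd r P \<Longrightarrow> r \<le> s \<Longrightarrow> x \<in> nbhd s P"
  by (auto simp: nbhd_def)

lemma nbhd_dist: "x \<in> nbhd r P \<Longrightarrow> dist y x \<le> d \<Longrightarrow> y \<in> nbhd (r + d) P"
  using infdist_triangle[of y P x] by (auto simp: nbhd_def)

lemma nbhd_mem: "x \<in> P \<Longrightarrow> 0 \<le> r \<Longrightarrow> x \<in> nbhd r P"
  by (auto simp: nbhd_def)

lemma infdist_approx:
  assumes "P \<noteq> {}" "0 < e"
  obtains p where "p \<in> P" "dist x p < infdist x P + e"
proof -
  have "(INF p\<in>P. dist x p) < infdist x P + e"
    using assms by (simp add: infdist_notempty)
  then show ?thesis using that assms(1) by (subst (asm) cINF_less_iff) auto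
qed

lemma nbhd_approx:
  assumes "x \<in> nbhd r P"
  obtains p where "p \<in> P" "dist x p \<le> r + 1"
proof -
  have "P \<noteq> {}" using assms by (auto simp: nbhd_def)
  then obtain p where "p \<in> P" "dist x p < infdist x P + 1"
    by (rule infdist_approx[OF _ zero_less_one])
  then show ?thesis using that[of p] assms by (auto simp: nbhd_def)
qed

lemma closed_nbhd: "closed (nbhd r P)"
proof (cases "P = {}")
  case False
  then have "nbhd r P = {x. infdist x P \<le> r}" by (auto simp: nbhd_def)
  then show ?thesis by (simp add: closed_Collect_le continuous_on_infdist)
qed (simp add: nbhd_def)

lemma closed_times:
  assumes "geod x y L g" "closed A" "0 \<le> a" "b \<le> L"
  shows "closed {t\<in>{a..b}. g t \<in> A}"
proof -
  have "continuous_on {a..b} g"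
    using geod_continuous[OF assms(1)] by (rule continuous_on_subset) (use assms in auto)
  then have "closed ({a..b} \<inter> g -` A)"
    by (rule continuous_closed_preimage[OF _ closed_atLeastAtMost assms(2)])
  moreover have "{t\<in>{a..b}. g t \<in> A} = {a..b} \<inter> g -` A" by auto
  ultimately show ?thesis by simp
qed

text \<open>Nearest points need not exist in \<open>P\<close>, so a slack \<rho> is allowed. It is a
  parameter, since moving \<open>x\<close> towards \<open>a\<close> along a path that is geodesic up
  to an error increases the slack by that error.\<close>

definition near_proj :: "'a::metric_space set \<Rightarrow> real \<Rightarrow> 'a \<Rightarrow> 'a \<Rightarrow> bool" where
  "near_proj P \<rho> x a \<longleftrightarrow> a \<in> P \<and> dist x a \<le> infdist x P + \<rho>"

lemma near_proj_ex:
  assumes "P \<noteq> {}"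
  shows "\<exists>a. near_proj P 1 x a"
proof -
  obtain p where "p \<in> P" "dist x p < infdist x P + 1"
    by (rule infdist_approx[OF assms zero_less_one])
  then show ?thesis by (intro exI[of _ p]) (simp add: near_proj_def)
qed

lemma near_proj_mono: "near_proj P r x a \<Longrightarrow> r \<le> s \<Longrightarrow> near_proj P s x a"
  by (auto simp: near_proj_def)

text \<open>Passing from \<open>x\<close> to \<open>y\<close> lowers the distance to
  \<open>P\<close> by at most \<open>dist x y\<close>, while the distance to \<open>a\<close> drops
  by that amount up to \<open>c\<close>.\<close>

lemma near_proj_between:
  assumes "near_proj P \<rho> x a" "dist x y + dist y a \<le> dist x a + c"
  shows "near_proj P (\<rho> + c) y a"
  using assms infdist_triangle[of x P y] by (auto simp: near_proj_def)

section \<open>Geodesic triangles in a relatively hyperbolic space\<close>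

locale rel_hyp =
  fixes \<P> :: "'a::metric_space set set" and \<epsilon> M \<sigma> \<delta> :: real and B :: "real \<Rightarrow> real"
  assumes geo: "\<And>x y :: 'a. \<exists>L g. geod x y L g"
    and \<epsilon>: "0 < \<epsilon>" and M0: "0 \<le> M"
    and B0: "\<And>K. 0 \<le> B K"
    and a1: "\<And>P Q K x y. \<lbrakk>P \<in> \<P>; Q \<in> \<P>; P \<noteq> Q; x \<in> nbhd K P; x \<in> nbhd K Q;
              y \<in> nbhd K P; y \<in> nbhd K Q\<rbrakk> \<Longrightarrow> dist x y \<le> B K"
    and a2: "\<And>P x y L g. \<lbrakk>P \<in> \<P>; x \<in> nbhd (\<epsilon> * dist x y) P; y \<in> nbhd (\<epsilon> * dist x y) P;
              geod x y L g\<rbrakk> \<Longrightarrow> g ` {0..L} \<inter> nbhd M P \<noteq> {}"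
    and tri: "\<And>L g. almost_geodesic_triangle 0 L g \<Longrightarrow>
              triangle_cond_C \<sigma> L g \<or> triangle_cond_P \<P> \<sigma> \<delta> L g"
begin

text \<open>Serves both alternatives of the triangle condition: two points of one ball of radius
  \<sigma> are at most \<open>2 * \<sigma>\<close> apart, and \<delta> bounds the distance from an
  exit point to the next entrance point.\<close>

definition D :: real where "D = max \<delta> (2 * \<sigma>)"

lemma geod_almost:
  assumes "geod x y L g"
  shows "almost_geodesic 1 0 L g"
  using assms geod_continuous[OF assms]
  by (auto simp: almost_geodesic_def quasi_geodesic_def geodD[OF assms])

text \<open>The times at which a continuous path is in a closed set form a compact set, so the
  infimum and the supremum are attained.\<close>

lemma entrance_exit:
  assumes g: "geod x y L g" and A: "closed A" and ne: "g ` {0..L} \<inter> A \<noteq> {}"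
  obtains e f where "0 \<le> e" "e \<le> f" "f \<le> L" "g e \<in> A" "g f \<in> A"
    "entrance_point L g A = g e" "exit_point L g A = g f"
proof -
  let ?S = "{t\<in>{0..L}. g t \<in> A}"
  have S: "closed ?S" "?S \<noteq> {}" "bdd_below ?S" "bdd_above ?S"
    using closed_times[OF g A, of 0 L] ne by (auto intro!: bdd_belowI[of _ 0] bdd_aboveI[of _ L])
  have 1: "Inf ?S \<in> ?S" using S by (intro closed_contains_Inf) auto
  have 2: "Sup ?S \<in> ?S" using S by (intro closed_contains_Sup) auto
  have 3: "Inf ?S \<le> Sup ?S" using 1 S by (intro cSup_upper) auto
  show ?thesis
    by (rule that[of "Inf ?S" "Sup ?S"]) (use 1 2 3 in \<open>auto simp: entrance_point_def exit_point_def\<close>)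
qed

text \<open>Both alternatives of the tree-graded condition in one form: in the first alternative
  \<open>e\<^sub>i = f\<^sub>i\<close>.\<close>

lemma triangle:
  assumes g: "geod x y L1 g1" "geod y z L2 g2" "geod z x L3 g3"
  obtains e1 f1 e2 f2 e3 f3 where
    "0 \<le> e1" "e1 \<le> f1" "f1 \<le> L1" "0 \<le> e2" "e2 \<le> f2" "f2 \<le> L2" "0 \<le> e3" "e3 \<le> f3" "f3 \<le> L3"
    "dist (g1 f1) (g2 e2) \<le> D" "dist (g2 f2) (g3 e3) \<le> D" "dist (g3 f3) (g1 e1) \<le> D"
    "(e1 = f1 \<and> e2 = f2 \<and> e3 = f3) \<or> (\<exists>Q\<in>\<P>. g1 e1 \<in> nbhd \<sigma> Q \<and> g1 f1 \<in> nbhd \<sigma> Q \<and>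
       g2 e2 \<in> nbhd \<sigma> Q \<and> g2 f2 \<in> nbhd \<sigma> Q \<and> g3 e3 \<in> nbhd \<sigma> Q \<and> g3 f3 \<in> nbhd \<sigma> Q)"
proof -
  define L where "L = (\<lambda>i::nat. if i = 0 then L1 else if i = 1 then L2 else L3)"
  define G where "G = (\<lambda>i::nat. if i = 0 then g1 else if i = 1 then g2 else g3)"
  have all3: "(\<forall>i<3. R i) \<longleftrightarrow> R 0 \<and> R 1 \<and> R 2" for R :: "nat \<Rightarrow> bool"
    by (auto simp: numeral_3_eq_3 less_Suc_eq numeral_2_eq_2)
  have "almost_geodesic_triangle 0 L G"
    unfolding almost_geodesic_triangle_def all3
    using geod_almost[OF g(1)] geod_almost[OF g(2)] geod_almost[OF g(3)]
      geodD(2,3)[OF g(1)] geodD(2,3)[OF g(2)] geodD(2,3)[OF g(3)]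
    by (auto simp: L_def G_def)
  from tri[OF this] show ?thesis
  proof
    assume "triangle_cond_C \<sigma> L G"
    then obtain c where "\<forall>i<3. G i ` {0..L i} \<inter> cball c \<sigma> \<noteq> {}"
      by (auto simp: triangle_cond_C_def)
    then have "g1 ` {0..L1} \<inter> cball c \<sigma> \<noteq> {}" "g2 ` {0..L2} \<inter> cball c \<sigma> \<noteq> {}"
      "g3 ` {0..L3} \<inter> cball c \<sigma> \<noteq> {}"
      unfolding all3 by (simp_all add: L_def G_def)
    then obtain t1 t2 t3 where t: "t1 \<in> {0..L1}" "t2 \<in> {0..L2}" "t3 \<in> {0..L3}"
      and d: "dist c (g1 t1) \<le> \<sigma>" "dist c (g2 t2) \<le> \<sigma>" "dist c (g3 t3) \<le> \<sigma>"
      unfolding disjoint_iff image_iff mem_cball by blast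
    have *: "dist u v \<le> D" if "dist c u \<le> \<sigma>" "dist c v \<le> \<sigma>" for u v
      using that dist_triangle3[of u v c] unfolding D_def by linarith
    show ?thesis
      by (rule that[of t1 t1 t2 t2 t3 t3]) (use t d * in auto)
  next
    assume "triangle_cond_P \<P> \<sigma> \<delta> L G"
    then obtain Q where Q: "Q \<in> \<P>"
      and ne: "\<forall>i<3. G i ` {0..L i} \<inter> nbhd \<sigma> Q \<noteq> {}"
      and dd: "\<forall>i<3. dist (exit_point (L i) (G i) (nbhd \<sigma> Q))
                 (entrance_point (L (Suc i mod 3)) (G (Suc i mod 3)) (nbhd \<sigma> Q)) \<le> \<delta>"
      by (auto simp: triangle_cond_P_def)
    have ne: "g1 ` {0..L1} \<inter> nbhd \<sigma> Q \<noteq> {}" "g2 ` {0..L2} \<inter> nbhd \<sigma> Q \<noteq> {}"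
      "g3 ` {0..L3} \<inter> nbhd \<sigma> Q \<noteq> {}"
      using ne unfolding all3 by (simp_all add: L_def G_def)
    obtain e1 f1 where 1: "0 \<le> e1" "e1 \<le> f1" "f1 \<le> L1" "g1 e1 \<in> nbhd \<sigma> Q" "g1 f1 \<in> nbhd \<sigma> Q"
      "entrance_point L1 g1 (nbhd \<sigma> Q) = g1 e1" "exit_point L1 g1 (nbhd \<sigma> Q) = g1 f1"
      using entrance_exit[OF g(1) closed_nbhd ne(1)] by blast
    obtain e2 f2 where 2: "0 \<le> e2" "e2 \<le> f2" "f2 \<le> L2" "g2 e2 \<in> nbhd \<sigma> Q" "g2 f2 \<in> nbhd \<sigma> Q"
      "entrance_point L2 g2 (nbhd \<sigma> Q) = g2 e2" "exit_point L2 g2 (nbhd \<sigma> Q) = g2 f2"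
      using entrance_exit[OF g(2) closed_nbhd ne(2)] by blast
    obtain e3 f3 where 3: "0 \<le> e3" "e3 \<le> f3" "f3 \<le> L3" "g3 e3 \<in> nbhd \<sigma> Q" "g3 f3 \<in> nbhd \<sigma> Q"
      "entrance_point L3 g3 (nbhd \<sigma> Q) = g3 e3" "exit_point L3 g3 (nbhd \<sigma> Q) = g3 f3"
      using entrance_exit[OF g(3) closed_nbhd ne(3)] by blast
    have "dist (g1 f1) (g2 e2) \<le> \<delta>" "dist (g2 f2) (g3 e3) \<le> \<delta>" "dist (g3 f3) (g1 e1) \<le> \<delta>"
      using dd 1 2 3 unfolding all3 by (simp_all add: L_def G_def)
    then have "dist (g1 f1) (g2 e2) \<le> D" "dist (g2 f2) (g3 e3) \<le> D" "dist (g3 f3) (g1 e1) \<le> D"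
      by (simp_all add: D_def)
    then show ?thesis
      by (intro that[of e1 f1 e2 f2 e3 f3] disjI2 bexI[of _ Q]) (use 1 2 3 Q in auto)
  qed
qed

text \<open>For negative \<sigma>, balls and peripheral neighbourhoods of that radius are empty, so
  a constant triangle would satisfy neither alternative.\<close>

lemma \<sigma>0: "0 \<le> \<sigma>"
proof -
  have g: "geod x x 0 (\<lambda>_. x)" for x :: 'a
    by (auto simp: geodesic_from_to_def geodesic_path_def)
  let ?x = "undefined :: 'a"
  have "almost_geodesic_triangle 0 (\<lambda>_. 0) (\<lambda>_ _. ?x)"
    using geod_almost[OF g[of ?x]] by (auto simp: almost_geodesic_triangle_def)
  from tri[OF this] show ?thesis
  proof
    assume "triangle_cond_C \<sigma> (\<lambda>_. 0) (\<lambda>_ _. ?x)"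
    then obtain z where "\<forall>i<3::nat. (\<lambda>_::real. ?x) ` {0..0} \<inter> cball z \<sigma> \<noteq> {}"
      by (auto simp: triangle_cond_C_def)
    then have "dist z ?x \<le> \<sigma>" by (auto dest!: spec[of _ 0])
    then show ?thesis using zero_le_dist[of z ?x] by linarith
  next
    assume "triangle_cond_P \<P> \<sigma> \<delta> (\<lambda>_. 0) (\<lambda>_ _. ?x)"
    then obtain P where "\<forall>i<3::nat. (\<lambda>_::real. ?x) ` {0..0} \<inter> nbhd \<sigma> P \<noteq> {}"
      by (auto simp: triangle_cond_P_def)
    then have "infdist ?x P \<le> \<sigma>" by (auto simp: nbhd_def dest!: spec[of _ 0])
    then show ?thesis using infdist_nonneg[of ?x P] by linarith
  qed
qed

lemma D0: "0 \<le> D"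
  using \<sigma>0 by (simp add: D_def)

section \<open>Quasiconvexity of peripheral sets\<close>

lemma gap:
  assumes g: "geod x y L g" and P: "P \<in> \<P>" and ab: "0 \<le> a" "b \<le> L" "0 \<le> r"
    and r: "g a \<in> nbhd r P" "g b \<in> nbhd r P"
    and none: "\<And>t. a < t \<Longrightarrow> t < b \<Longrightarrow> g t \<notin> nbhd M P"
  shows "b - a \<le> (r + 1) / \<epsilon> + 2"
proof (rule ccontr)
  assume *: "\<not> ?thesis"
  \<comment> \<open>The ends of the geodesic handed to \<open>a2\<close> might themselves lie in
    \<open>nbhd M P\<close>. Moving both inwards by \<open>1\<close> makes the point found an inner
    one, at the price of the radius \<open>r + 1\<close>.\<close>
  define a' b' where "a' = a + 1" and "b' = b - 1"
  have "0 < (r + 1) / \<epsilon>" using \<epsilon> ab by simp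
  then have ab': "a' < b'" and le: "(r + 1) / \<epsilon> \<le> b' - a'"
    using * by (auto simp: a'_def b'_def)
  have d: "dist (g a') (g b') = b' - a'"
    using geodD(5)[OF g, of a' b'] ab ab' by (auto simp: a'_def b'_def)
  have "r + 1 \<le> \<epsilon> * (b' - a')" using le \<epsilon> by (simp add: field_simps)
  moreover have "g a' \<in> nbhd (r + 1) P"
    by (rule nbhd_dist[OF r(1)]) (use geodD(5)[OF g, of a' a] ab ab' in \<open>auto simp: a'_def b'_def\<close>)
  moreover have "g b' \<in> nbhd (r + 1) P"
    by (rule nbhd_dist[OF r(2)]) (use geodD(5)[OF g, of b' b] ab ab' in \<open>auto simp: a'_def b'_def\<close>)
  ultimately have "g a' \<in> nbhd (\<epsilon> * dist (g a') (g b')) P" "g b' \<in> nbhd (\<epsilon> * dist (g a') (g b')) P"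
    unfolding d by (auto simp: nbhd_def)
  from a2[OF P this geod_sub[OF g]] ab ab' have
    "(\<lambda>t. g (a' + t)) ` {0..b' - a'} \<inter> nbhd M P \<noteq> {}" by (simp add: a'_def b'_def)
  then obtain t where "t \<in> {0..b' - a'}" "g (a' + t) \<in> nbhd M P" by blast
  then show False using none[of "a' + t"] by (auto simp: a'_def b'_def)
qed

text \<open>The radius \<open>max r M\<close> enlarged by the longest excursion that
  \<open>gap\<close> permits for it.\<close>

definition qc :: "real \<Rightarrow> real" where
  "qc r = max r M + (max r M + 1) / \<epsilon> + 2"

lemma qc_ge: "r \<le> qc r" "M \<le> qc r" "0 \<le> qc r"
proof -
  have "0 \<le> (max r M + 1) / \<epsilon>" using M0 \<epsilon> by (intro divide_nonneg_pos) auto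
  then show "r \<le> qc r" "M \<le> qc r" by (auto simp: qc_def)
  then show "0 \<le> qc r" using M0 by linarith
qed

text \<open>Take the last visit to \<open>nbhd (max r M) P\<close> before time \<open>t\<close> and
  the first one after it. In between the geodesic avoids \<open>nbhd M P\<close>, so by
  \<open>gap\<close> this excursion is short and \<open>g t\<close> is close to its start.\<close>

lemma quasiconvex:
  assumes g: "geod x y L g" and P: "P \<in> \<P>" and xy: "x \<in> nbhd r P" "y \<in> nbhd r P"
    and t: "t \<in> {0..L}"
  shows "g t \<in> nbhd (qc r) P"
proof -
  let ?r = "max r M"
  let ?S = "{s\<in>{0..t}. g s \<in> nbhd ?r P}" and ?S' = "{s\<in>{t..L}. g s \<in> nbhd ?r P}"
  have x: "x \<in> nbhd ?r P" "y \<in> nbhd ?r P" using xy by (auto simp: nbhd_def)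
  define a b where "a = Sup ?S" and "b = Inf ?S'"
  have S: "?S \<noteq> {}" "bdd_above ?S" "?S' \<noteq> {}" "bdd_below ?S'"
    using x geodD(1-3)[OF g] t by (auto intro!: bdd_aboveI[of _ t] bdd_belowI[of _ t])
  have aS: "a \<in> ?S" unfolding a_def using S t
    by (intro closed_contains_Sup closed_times[OF g closed_nbhd]) auto
  have bS: "b \<in> ?S'" unfolding b_def using S t
    by (intro closed_contains_Inf closed_times[OF g closed_nbhd]) auto
  have "g s \<notin> nbhd M P" if s: "a < s" "s < b" for s
  proof
    assume "g s \<in> nbhd M P"
    then have "g s \<in> nbhd ?r P" by (rule nbhd_mono) simp
    then have "s \<in> ?S \<or> s \<in> ?S'" using s aS bS by auto
    then have "s \<le> a \<or> b \<le> s" using S unfolding a_def b_def by (meson cSup_upper cInf_lower)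
    then show False using s by linarith
  qed
  then have "b - a \<le> (?r + 1) / \<epsilon> + 2"
    using aS bS M0 by (intro gap[OF g P]) auto
  moreover have "dist (g t) (g a) = t - a" using geodD(5)[OF g, of t a] aS t by auto
  moreover have "t \<le> b" using bS by auto
  ultimately have "g t \<in> nbhd (?r + ((?r + 1) / \<epsilon> + 2)) P"
    using aS by (intro nbhd_dist[of "g a"]) auto
  then show ?thesis by (simp add: qc_def algebra_simps)
qed

lemma quasiconvex_between:
  assumes g: "geod x y L g" and P: "P \<in> \<P>" and st: "0 \<le> s" "s \<le> u" "u \<le> t" "t \<le> L"
    and r: "g s \<in> nbhd r P" "g t \<in> nbhd r P"
  shows "g u \<in> nbhd (qc r) P"
  using quasiconvex[OF geod_sub[OF g st(1) _ st(4)] P r, of "u - s"] st by simp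

section \<open>Coarse properties of the projection to a peripheral set\<close>

definition gc :: "real \<Rightarrow> real \<Rightarrow> real" where
  "gc r \<rho> = 3 * D + 2 * B (max \<sigma> (qc r)) + qc r + \<rho> + \<sigma>"

text \<open>In the triangle \<open>x\<close>, \<open>v\<close>, \<open>a\<close>, the side from
  \<open>v\<close> to \<open>a\<close> stays near \<open>P\<close> by quasiconvexity. On the side
  from \<open>a\<close> to \<open>x\<close> the point \<open>a\<close> remains an almost nearest
  point, so any point of that side near \<open>P\<close> is near \<open>a\<close>. It suffices to
  reach such a point from \<open>g\<close>; \<open>gc\<close> dominates the jumps needed for
  this.\<close>

lemma proj_near_geod:
  assumes P: "P \<in> \<P>" and a: "near_proj P \<rho> x a" and v: "v \<in> nbhd r P" and g: "geod x v L g"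
    and r: "0 \<le> r"
  shows "\<exists>t\<in>{0..L}. dist (g t) a \<le> gc r \<rho>"
proof -
  obtain L2 g2 where g2: "geod v a L2 g2" using geo by blast
  obtain L3 g3 where g3: "geod a x L3 g3" using geo by blast
  obtain e1 f1 e2 f2 e3 f3 where
    e: "0 \<le> e1" "e1 \<le> f1" "f1 \<le> L" "0 \<le> e2" "e2 \<le> f2" "f2 \<le> L2" "0 \<le> e3" "e3 \<le> f3" "f3 \<le> L3"
    and d: "dist (g f1) (g2 e2) \<le> D" "dist (g2 f2) (g3 e3) \<le> D" "dist (g3 f3) (g e1) \<le> D"
    and Q: "(e1 = f1 \<and> e2 = f2 \<and> e3 = f3) \<or> (\<exists>Q\<in>\<P>. g e1 \<in> nbhd \<sigma> Q \<and> g f1 \<in> nbhd \<sigma> Q \<and>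
       g2 e2 \<in> nbhd \<sigma> Q \<and> g2 f2 \<in> nbhd \<sigma> Q \<and> g3 e3 \<in> nbhd \<sigma> Q \<and> g3 f3 \<in> nbhd \<sigma> Q)"
    using triangle[OF g g2 g3] by blast
  have "a \<in> nbhd r P" using a r by (auto simp: near_proj_def intro: nbhd_mem)
  then have g2P: "g2 t \<in> nbhd (qc r) P" if "t \<in> {0..L2}" for t
    using quasiconvex[OF g2 P v] that by blast
  have g3a: "dist (g3 t) a \<le> infdist (g3 t) P + \<rho>" if "t \<in> {0..L3}" for t
  proof -
    have "near_proj P (\<rho> + 0) (g3 t) a"
      by (rule near_proj_between[OF a])
        (use geodD(4,6,7)[OF g3] that in \<open>auto simp: dist_commute\<close>)
    then show ?thesis by (simp add: near_proj_def)
  qed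
  have qc0: "0 \<le> qc r" "0 \<le> D" "0 \<le> \<sigma>" "0 \<le> B (max \<sigma> (qc r))" "0 \<le> \<rho> + qc r"
  proof -
    show "0 \<le> \<rho> + qc r"
    proof -
      have "infdist x P \<le> dist x a" using a by (auto simp: near_proj_def intro: infdist_le)
      then show ?thesis using a qc_ge(3)[of r] by (auto simp: near_proj_def)
    qed
  qed (use qc_ge D0 \<sigma>0 B0 in auto)
  show ?thesis
  proof (cases "\<exists>t\<in>{0..L3}. g3 t \<in> nbhd \<sigma> P \<and> (\<exists>s\<in>{0..L}. dist (g3 t) (g s) \<le> D)")
    case True
    then obtain t s where ts: "t \<in> {0..L3}" "g3 t \<in> nbhd \<sigma> P" "s \<in> {0..L}" "dist (g3 t) (g s) \<le> D"
      by blast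
    have "dist (g s) a \<le> D + (\<sigma> + \<rho>)"
      using ts g3a[OF ts(1)] dist_triangle[of "g s" a "g3 t"]
      by (auto simp: nbhd_def dist_commute)
    moreover have "D + (\<sigma> + \<rho>) \<le> gc r \<rho>"
      using qc0 by (auto simp: gc_def)
    ultimately show ?thesis using ts(3) by (meson order_trans)
  next
    case False
    \<comment> \<open>The entrance and exit points of \<open>g2\<close> lie near \<open>P\<close>.
      If they also lie near some \<open>Q\<close>, the excluded case forces
      \<open>Q \<noteq> P\<close>, as otherwise \<open>g3 f3\<close> would be near \<open>P\<close>
      and within \<open>D\<close> of \<open>g\<close>. So the overlap of two distinct peripheral
      neighbourhoods bounds their distance.\<close>
    have B: "dist (g2 e2) (g2 f2) \<le> B (max \<sigma> (qc r))"
      using Q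
    proof
      assume "\<exists>Q\<in>\<P>. g e1 \<in> nbhd \<sigma> Q \<and> g f1 \<in> nbhd \<sigma> Q \<and>
       g2 e2 \<in> nbhd \<sigma> Q \<and> g2 f2 \<in> nbhd \<sigma> Q \<and> g3 e3 \<in> nbhd \<sigma> Q \<and> g3 f3 \<in> nbhd \<sigma> Q"
      then obtain Q where Q: "Q \<in> \<P>" "g2 e2 \<in> nbhd \<sigma> Q" "g2 f2 \<in> nbhd \<sigma> Q" "g3 f3 \<in> nbhd \<sigma> Q"
        by blast
      have "Q \<noteq> P"
      proof
        assume "Q = P"
        then show False using False Q d e by (meson atLeastAtMost_iff order_trans)
      qed
      then show ?thesis
        using Q g2P[of e2] g2P[of f2] e by (intro a1[of Q P]) (auto simp: P nbhd_def)
    qed (simp add: B0)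
    have "g3 e3 \<in> nbhd (qc r + D) P"
      by (rule nbhd_dist[OF g2P[of f2]]) (use e d in \<open>auto simp: dist_commute\<close>)
    then have "dist (g3 e3) a \<le> qc r + D + \<rho>"
      using g3a[of e3] e by (auto simp: nbhd_def)
    then have "dist (g f1) a \<le> D + B (max \<sigma> (qc r)) + D + (qc r + D + \<rho>)"
      using d B dist_triangle[of "g f1" a "g2 e2"] dist_triangle[of "g2 e2" a "g2 f2"]
        dist_triangle[of "g2 f2" a "g3 e3"] by linarith
    also have "\<dots> \<le> gc r \<rho>" using qc0 by (auto simp: gc_def)
    finally show ?thesis using e by (intro bexI[of _ f1]) auto
  qed
qed

text \<open>The detour through \<open>a\<close> is cheap because the geodesic passes near it: almost
  nearest points are coarse gates to \<open>P\<close>.\<close>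

lemma proj_dist:
  assumes P: "P \<in> \<P>" and a: "near_proj P \<rho> x a" and v: "v \<in> nbhd r P" and r: "0 \<le> r"
  shows "dist x a + dist a v \<le> dist x v + 2 * gc r \<rho>"
proof -
  obtain L g where g: "geod x v L g" using geo by blast
  obtain t where t: "t \<in> {0..L}" "dist (g t) a \<le> gc r \<rho>" using proj_near_geod[OF P a v g r] by blast
  have "dist x v = dist x (g t) + dist (g t) v" using geodD(4,6,7)[OF g] t by simp
  then show ?thesis
    using t dist_triangle[of x a "g t"] dist_triangle[of a v "g t"] by (simp add: dist_commute)
qed

text \<open>The gate property bounds \<open>dist a b\<close> by the difference of
  \<open>dist x b\<close> and \<open>dist x a\<close>, and both are compared with distances to
  \<open>P\<close>, which differ by at most \<open>dist x y\<close> between \<open>x\<close> and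
  \<open>y\<close>.\<close>

lemma proj_lipschitz:
  assumes P: "P \<in> \<P>" and a: "near_proj P \<rho> x a" and b: "near_proj P \<rho> y b"
  shows "dist a b \<le> 2 * dist x y + \<rho> + 2 * gc 0 \<rho>"
proof -
  have "b \<in> nbhd 0 P" using b by (auto simp: near_proj_def intro: nbhd_mem)
  then have "dist x a + dist a b \<le> dist x b + 2 * gc 0 \<rho>" using proj_dist[OF P a] by simp
  moreover have "dist x b \<le> dist x y + dist y b" by (rule dist_triangle)
  moreover have "dist y b \<le> infdist y P + \<rho>" using b by (simp add: near_proj_def)
  moreover have "infdist y P \<le> infdist x P + dist x y"
    using infdist_triangle[of y P x] by (simp add: dist_commute)
  moreover have "infdist x P \<le> dist x a" using a by (auto simp: near_proj_def intro: infdist_le)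
  ultimately show ?thesis by linarith
qed

text \<open>In the triangle \<open>x\<close>, \<open>y\<close>, \<open>b\<close>, the side from
  \<open>b\<close> to \<open>x\<close> has a point \<open>g3 t\<close> close to \<open>a\<close>.
  Before it this side runs near \<open>P\<close>, and after it \<open>a\<close> is an almost nearest
  point. As \<open>g\<close> stays away from \<open>P\<close>, its contact \<open>g3 f3\<close>
  comes after \<open>g3 t\<close>; the cases depend on the position of the contact
  \<open>g3 e3\<close> with \<open>g2\<close>.\<close>

lemma proj_contracting:
  "\<exists>c R. 0 \<le> c \<and> (\<forall>P\<in>\<P>. \<forall>x y a b L g. near_proj P 1 x a \<longrightarrow> near_proj P 1 y b \<longrightarrow> geod x y L g \<longrightarrow>
     (\<forall>t\<in>{0..L}. g t \<notin> nbhd c P) \<longrightarrow> dist a b \<le> R)"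
proof -
  define C where "C = gc 0 1"
  define q where "q = qc C"
  define q' where "q' = qc \<sigma>"
  define K where "K = Max {C, q, q', \<sigma>}"
  define \<rho> where "\<rho> = 1 + 2 * C"
  define R where "R = max (2 * D + \<rho> + 2 * gc 0 \<rho>) (C + B K + D + (q + D + 1))"
  \<comment> \<open>The bound \<sigma> excludes \<open>Q = P\<close> below, and \<open>q + D\<close>
    keeps \<open>g\<close> from being \<open>D\<close>-close to the part of \<open>g3\<close> near
    \<open>P\<close>.\<close>
  define c where "c = max \<sigma> (q + D)"
  have C0: "0 \<le> C" using qc_ge(3)[of 0] D0 \<sigma>0 B0 by (simp add: C_def gc_def)
  have K: "C \<le> K" "q \<le> K" "q' \<le> K" "\<sigma> \<le> K" by (auto simp: K_def)
  have "dist a b \<le> R"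
    if P: "P \<in> \<P>" and a: "near_proj P 1 x a" and b: "near_proj P 1 y b" and g: "geod x y L g"
      and none: "\<And>t. t \<in> {0..L} \<Longrightarrow> g t \<notin> nbhd c P" for P x y a b L g
  proof -
    obtain L2 g2 where g2: "geod y b L2 g2" using geo by blast
    obtain L3 g3 where g3: "geod b x L3 g3" using geo by blast
    obtain e1 f1 e2 f2 e3 f3 where
      e: "0 \<le> e1" "e1 \<le> f1" "f1 \<le> L" "0 \<le> e2" "e2 \<le> f2" "f2 \<le> L2" "0 \<le> e3" "e3 \<le> f3" "f3 \<le> L3"
      and d: "dist (g f1) (g2 e2) \<le> D" "dist (g2 f2) (g3 e3) \<le> D" "dist (g3 f3) (g e1) \<le> D"
      and Q: "(e1 = f1 \<and> e2 = f2 \<and> e3 = f3) \<or> (\<exists>Q\<in>\<P>. g e1 \<in> nbhd \<sigma> Q \<and> g f1 \<in> nbhd \<sigma> Q \<and>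
         g2 e2 \<in> nbhd \<sigma> Q \<and> g2 f2 \<in> nbhd \<sigma> Q \<and> g3 e3 \<in> nbhd \<sigma> Q \<and> g3 f3 \<in> nbhd \<sigma> Q)"
      using triangle[OF g g2 g3] by blast
    have aP: "a \<in> P" and bP: "b \<in> P" using a b by (auto simp: near_proj_def)
    obtain t where t: "t \<in> {0..L3}" "dist (g3 t) a \<le> C"
    proof -
      obtain t where "t \<in> {0..L3}" "dist (g3 (L3 - t)) a \<le> C"
        using proj_near_geod[OF P a nbhd_mem[OF bP order_refl] geod_rev[OF g3]] by (auto simp: C_def)
      then show ?thesis using that[of "L3 - t"] by auto
    qed
    have wP: "g3 t \<in> nbhd C P"
      using t(2) nbhd_dist[of a 0 P "g3 t" C] aP by (auto intro: nbhd_mem)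
    have inP: "g3 u \<in> nbhd q P" if "u \<in> {0..t}" for u
      unfolding q_def
      by (rule quasiconvex_between[OF g3 P, of 0 u t])
        (use that t wP bP C0 geodD(2)[OF g3] in \<open>auto intro: nbhd_mem\<close>)
    have pa: "near_proj P \<rho> (g3 u) a" if "u \<in> {t..L3}" for u
      unfolding \<rho>_def
    proof (rule near_proj_between[OF a])
      have "dist x (g3 u) = L3 - u" "dist x (g3 t) = L3 - t" "dist (g3 u) (g3 t) = u - t"
        using geodD(7)[OF g3, of u] geodD(7)[OF g3, of t] geodD(5)[OF g3, of u t] that t
        by (auto simp: dist_commute)
      then show "dist x (g3 u) + dist (g3 u) a \<le> dist x a + 2 * C"
        using t(2) dist_triangle[of "g3 u" a "g3 t"] dist_triangle[of x "g3 t" a]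
        by (simp add: dist_commute)
    qed
    have pb: "near_proj P 1 (g2 u) b" if "u \<in> {0..L2}" for u
      using near_proj_between[OF b, of "g2 u" 0] geodD(4,6,7)[OF g2] that by auto
    have e1: "g e1 \<notin> nbhd c P" using none e by auto
    have f3: "t < f3"
    proof (rule ccontr)
      assume "\<not> t < f3"
      then have "g e1 \<in> nbhd (q + D) P"
        using e d by (intro nbhd_dist[OF inP[of f3]]) (auto simp: dist_commute)
      then show False using e1 by (auto simp: c_def nbhd_def)
    qed
    show ?thesis
    proof (cases "t \<le> e3")
      \<comment> \<open>The contact with \<open>g2\<close> also lies beyond \<open>g3 t\<close>, so
        two points at distance at most \<open>D\<close> have the almost nearest points
        \<open>a\<close> and \<open>b\<close>.\<close>
      case True
      then have "near_proj P \<rho> (g3 e3) a" using pa e by auto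
      moreover have "near_proj P \<rho> (g2 f2) b"
        using near_proj_mono[OF pb[of f2]] e C0 by (auto simp: \<rho>_def)
      ultimately have "dist a b \<le> 2 * dist (g3 e3) (g2 f2) + \<rho> + 2 * gc 0 \<rho>"
        by (rule proj_lipschitz[OF P])
      also have "\<dots> \<le> R" using d(2) by (auto simp: R_def dist_commute)
      finally show ?thesis .
    next
      case False
      \<comment> \<open>Since \<open>e3 < t < f3\<close>, the degenerate alternative is impossible.
        Both \<open>g3 e3\<close> and \<open>g3 t\<close> lie near \<open>P\<close> and near
        \<open>Q\<close>, hence close to each other.\<close>
      then obtain Q where Q: "Q \<in> \<P>" "g e1 \<in> nbhd \<sigma> Q" "g3 e3 \<in> nbhd \<sigma> Q" "g3 f3 \<in> nbhd \<sigma> Q"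
        using Q f3 by auto
      have "Q \<noteq> P" using Q e1 by (auto simp: c_def nbhd_def)
      have "g3 t \<in> nbhd q' Q" unfolding q'_def
        by (rule quasiconvex_between[OF g3 Q(1), of e3 t f3]) (use e Q False f3 in auto)
      then have "dist (g3 e3) (g3 t) \<le> B K"
        using Q wP inP[of e3] e False K
        by (intro a1[OF Q(1) P \<open>Q \<noteq> P\<close>]) (auto simp: nbhd_def)
      moreover have "g2 f2 \<in> nbhd (q + D) P"
        using d e False by (intro nbhd_dist[OF inP[of e3]]) auto
      then have "dist (g2 f2) b \<le> q + D + 1"
        using pb[of f2] e by (auto simp: near_proj_def nbhd_def)
      ultimately have "dist a b \<le> C + B K + D + (q + D + 1)"
        using t(2) d(2) dist_triangle[of a b "g3 t"] dist_triangle[of "g3 t" b "g3 e3"]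
          dist_triangle[of "g3 e3" b "g2 f2"] by (simp add: dist_commute)
      then show ?thesis by (simp add: R_def)
    qed
  qed
  moreover have "0 \<le> c" using \<sigma>0 by (simp add: c_def)
  ultimately show ?thesis by blast
qed

text \<open>A geodesic joining two points of \<open>Q\<close> either avoids a neighbourhood of
  \<open>P\<close>, and contraction applies, or enters it. Then its parts from the two ends to the
  meeting point pass close to \<open>a\<close> and \<open>b\<close>, which places both points of
  \<open>P\<close> near \<open>Q\<close>, where \<open>a1\<close> applies.\<close>

lemma proj_other_bounded:
  "\<exists>R. \<forall>P\<in>\<P>. \<forall>Q\<in>\<P>. P \<noteq> Q \<longrightarrow> (\<forall>u\<in>Q. \<forall>v\<in>Q. \<forall>a b. near_proj P 1 u a \<longrightarrow> near_proj P 1 v b \<longrightarrow>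
     dist a b \<le> R)"
proof -
  obtain c R where c: "0 \<le> c" and R: "\<And>P x y a b L g. P \<in> \<P> \<Longrightarrow> near_proj P 1 x a \<Longrightarrow>
      near_proj P 1 y b \<Longrightarrow> geod x y L g \<Longrightarrow> (\<forall>t\<in>{0..L}. g t \<notin> nbhd c P) \<Longrightarrow> dist a b \<le> R"
    using proj_contracting by metis
  define q where "q = qc 0"
  define K where "K = q + gc c 1"
  have q0: "0 \<le> q" "0 \<le> gc c 1"
    using qc_ge(3)[of 0] qc_ge(3)[of c] D0 \<sigma>0 B0 by (auto simp: q_def gc_def)
  have "dist a b \<le> max R (B K)"
    if P: "P \<in> \<P>" and Q: "Q \<in> \<P>" "P \<noteq> Q" "u \<in> Q" "v \<in> Q" and a: "near_proj P 1 u a"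
      and b: "near_proj P 1 v b" for P Q u v a b
  proof -
    obtain L g where g: "geod u v L g" using geo by blast
    show ?thesis
    proof (cases "\<forall>t\<in>{0..L}. g t \<notin> nbhd c P")
      case True
      then show ?thesis using R[OF P a b g] by simp
    next
      case False
      then obtain t where t: "t \<in> {0..L}" "g t \<in> nbhd c P" by blast
      have gQ: "g s \<in> nbhd q Q" if "s \<in> {0..L}" for s
        unfolding q_def using quasiconvex[OF g Q(1)] Q that by (auto intro: nbhd_mem)
      have "geod u (g t) (t - 0) (\<lambda>s. g (0 + s))"
        using geod_sub[OF g, of 0 t] t geodD(2)[OF g] by auto
      then obtain s where s: "s \<in> {0..t}" "dist (g s) a \<le> gc c 1"
        using proj_near_geod[OF P a t(2) _ c] by fastforce
      have "geod v (g t) (L - t) (\<lambda>s. g (L - s))"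
        using geod_sub[OF geod_rev[OF g], of 0 "L - t"] t geodD(3)[OF g] by auto
      then obtain s' where s': "s' \<in> {0..L - t}" "dist (g (L - s')) b \<le> gc c 1"
        using proj_near_geod[OF P b t(2) _ c] by fastforce
      have "a \<in> nbhd K Q" unfolding K_def
        by (rule nbhd_dist[OF gQ[of s]]) (use s t in \<open>auto simp: dist_commute\<close>)
      moreover have "b \<in> nbhd K Q" unfolding K_def
        by (rule nbhd_dist[OF gQ[of "L - s'"]]) (use s' t in \<open>auto simp: dist_commute\<close>)
      moreover have "a \<in> nbhd K P" "b \<in> nbhd K P"
        using a b q0 by (auto simp: near_proj_def K_def intro!: nbhd_mem)
      ultimately have "dist a b \<le> B K" using a1[OF P Q(1,2)] by blast
      then show ?thesis by simp
    qed
  qed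
  then show ?thesis by blast
qed

end

section \<open>The coned metric\<close>

lemma edge_point_0 [simp]: "edge_point P x y 0 = Base x"
  and edge_point_1 [simp]: "edge_point P x y 1 = Base y"
  by (auto simp: edge_point_def)

lemma edge_point_swap:
  assumes "x \<noteq> y"
  shows "edge_point P y x (1 - r) = edge_point P x y r"
  using assms by (auto simp: edge_point_def)

text \<open>An interior point remembers its barycentric weights, whose support consists of the two
  endpoints; only the orientation of the edge is lost.\<close>

lemma edge_point_inj:
  assumes "edge_point P x y r = edge_point P' x' y' s" "x \<noteq> y" "x' \<noteq> y'" "0 < r" "r < 1"
    "0 \<le> s" "s \<le> 1"
  shows "P' = P \<and> (x' = x \<and> y' = y \<and> s = r \<or> x' = y \<and> y' = x \<and> s = 1 - r)"
proof -
  have s: "0 < s" "s < 1"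
    using assms by (auto simp: edge_point_def split: if_splits)
  have P: "P' = P" and
    *: "(\<lambda>z. if z = x then 1 - r else if z = y then r else 0) =
        (\<lambda>z. if z = x' then 1 - s else if z = y' then s else 0)"
    using assms s by (auto simp: edge_point_def)
  have "x = x' \<or> x = y'" "y = x' \<or> y = y'"
    using fun_cong[OF *, of x] fun_cong[OF *, of y] assms by (auto split: if_splits)
  then show ?thesis
    using P assms fun_cong[OF *, of x] fun_cong[OF *, of y] by auto
qed

locale coned =
  fixes \<P> :: "'a::metric_space set set" and N :: "'a set \<Rightarrow> 'a set"
begin

section \<open>Path lengths and the coned distance\<close>

abbreviation "cpl \<equiv> coned_path_length \<P> N"
abbreviation "cd \<equiv> coned_dist \<P> N"
abbreviation "E \<equiv> is_edge \<P> N"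
abbreviation dh :: "'a \<Rightarrow> 'a \<Rightarrow> real" where "dh x y \<equiv> cd (Base x) (Base y)"

lemma E_sym: "E P x y \<Longrightarrow> E P y x"
  by (auto simp: is_edge_def)

lemma E_neq: "E P x y \<Longrightarrow> x \<noteq> y"
  by (simp add: is_edge_def)

lemma Base_mem [simp]: "Base x \<in> coned_off \<P> N"
  by (simp add: coned_off_def)

lemma edge_mem: "E P x y \<Longrightarrow> r \<in> {0..1} \<Longrightarrow> edge_point P x y r \<in> coned_off \<P> N"
  unfolding coned_off_def by blast

lemma cpl_nonneg: "cpl p q l \<Longrightarrow> 0 \<le> l"
  by (induction rule: coned_path_length.induct) auto

lemma cpl_trans: "cpl p q l \<Longrightarrow> cpl q r l' \<Longrightarrow> cpl p r (l + l')"
proof (induction rule: coned_path_length.induct)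
  case (base y q l x)
  then show ?case
    using coned_path_length.base[of \<P> N y r "l + l'" x] by (simp add: add.assoc)
next
  case (edge P x y s t q l)
  then show ?case
    using coned_path_length.edge[of \<P> N P x y s t r "l + l'"] by (simp add: add.assoc)
qed auto

lemma cpl_base: "cpl (Base x) (Base y) (dist x y)"
  using coned_path_length.base[OF coned_path_length.refl[OF Base_mem], of x y] by simp

lemma cpl_edge:
  "E P x y \<Longrightarrow> s \<in> {0..1} \<Longrightarrow> t \<in> {0..1} \<Longrightarrow> cpl (edge_point P x y s) (edge_point P x y t) \<bar>s - t\<bar>"
  using coned_path_length.edge[of \<P> N P x y s t "edge_point P x y t" 0]
    coned_path_length.refl[OF edge_mem[of P x y t]] by simp

lemma cpl_sym: "cpl p q l \<Longrightarrow> cpl q p l"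
proof (induction rule: coned_path_length.induct)
  case (refl p)
  then show ?case by (rule coned_path_length.refl)
next
  case (base y q l x)
  then show ?case using cpl_trans[OF base.IH cpl_base[of y x]] by (simp add: dist_commute add.commute)
next
  case (edge P x y s t q l)
  then show ?case
    using cpl_trans[OF edge.IH cpl_edge[of P x y t s]] by (simp add: abs_minus_commute add.commute)
qed

lemma cpl_to_base:
  assumes "p \<in> coned_off \<P> N"
  shows "\<exists>l. cpl p (Base x) l"
proof -
  consider a where "p = Base a" | P u v t where "p = edge_point P u v t" "E P u v" "t \<in> {0..1}"
    using assms by (auto simp: coned_off_def)
  then show ?thesis
  proof cases
    case 1
    then show ?thesis using cpl_base by blast
  next
    case 2
    then show ?thesis
      using cpl_trans[OF cpl_edge[OF 2(2,3), of 0] cpl_base[of u x, folded edge_point_0[of P u v]]]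
      by auto
  qed
qed

lemma cpl_ex:
  assumes "p \<in> coned_off \<P> N" "q \<in> coned_off \<P> N"
  shows "\<exists>l. cpl p q l"
  using cpl_to_base[OF assms(1), of undefined] cpl_to_base[OF assms(2), of undefined]
    cpl_trans cpl_sym by blast

lemma cd_le: "cpl p q l \<Longrightarrow> cd p q \<le> l"
  unfolding coned_dist_def by (intro cInf_lower bdd_belowI[of _ 0]) (auto intro: cpl_nonneg)

lemma cd_ge:
  assumes "p \<in> coned_off \<P> N" "q \<in> coned_off \<P> N" "\<And>l. cpl p q l \<Longrightarrow> c \<le> l"
  shows "c \<le> cd p q"
  unfolding coned_dist_def using cpl_ex[OF assms(1,2)] assms(3) by (intro cInf_greatest) auto

lemma cd_nonneg: "p \<in> coned_off \<P> N \<Longrightarrow> q \<in> coned_off \<P> N \<Longrightarrow> 0 \<le> cd p q"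
  by (rule cd_ge) (auto intro: cpl_nonneg)

lemma cd_less:
  assumes "p \<in> coned_off \<P> N" "q \<in> coned_off \<P> N" "cd p q < c"
  obtains l where "cpl p q l" "l < c"
  using cd_ge[OF assms(1,2), of c] assms(3) by (meson not_le)

lemma cd_sym: "cd p q = cd q p"
proof -
  have "cpl p q = cpl q p" using cpl_sym by blast
  then show ?thesis by (simp add: coned_dist_def)
qed

lemma cd_triangle:
  assumes "p \<in> coned_off \<P> N" "q \<in> coned_off \<P> N" "r \<in> coned_off \<P> N"
  shows "cd p r \<le> cd p q + cd q r"
proof (rule field_le_epsilon)
  fix e :: real assume e: "0 < e"
  obtain l where l: "cpl p q l" "l < cd p q + e / 2"
    using cd_less[OF assms(1,2), of "cd p q + e/2"] e by auto
  obtain l' where l': "cpl q r l'" "l' < cd q r + e / 2"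
    using cd_less[OF assms(2,3), of "cd q r + e/2"] e by auto
  show "cd p r \<le> cd p q + cd q r + e"
    using cd_le[OF cpl_trans[OF l(1) l'(1)]] l(2) l'(2) by linarith
qed

lemma dh_triangle: "dh x z \<le> dh x y + dh y z"
  by (rule cd_triangle) auto

lemma dh_nonneg [simp]: "0 \<le> dh x y"
  by (rule cd_nonneg) auto

lemma dh_le_dist: "dh x y \<le> dist x y"
  by (rule cd_le[OF cpl_base])

lemma dh_refl [simp]: "dh x x = 0"
  using dh_le_dist[of x x] dh_nonneg[of x x] by simp

lemma cd_edge: "E P x y \<Longrightarrow> s \<in> {0..1} \<Longrightarrow> t \<in> {0..1} \<Longrightarrow>
    cd (edge_point P x y s) (edge_point P x y t) \<le> \<bar>s - t\<bar>"
  by (rule cd_le[OF cpl_edge])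

lemma dh_net:
  assumes "P \<in> \<P>" "x \<in> N P" "y \<in> N P"
  shows "dh x y \<le> 1"
proof (cases "x = y")
  case False
  then show ?thesis using cd_edge[of P x y 0 1] assms by (simp add: is_edge_def)
qed simp

text \<open>An interior point lies on one edge only, so a step along an edge from it stays on that
  edge, possibly written in the opposite direction. The edge can be left only through an endpoint,
  at the cost of the distance to it.\<close>

lemma cpl_escape:
  assumes "cpl p q l" "E P x y" "r \<in> {0..1}" "p = edge_point P x y r"
  shows "(\<exists>s\<in>{0..1}. q = edge_point P x y s \<and> \<bar>r - s\<bar> \<le> l) \<or>
    (\<exists>l'. cpl (Base x) q l' \<and> r + l' \<le> l) \<or> (\<exists>l'. cpl (Base y) q l' \<and> 1 - r + l' \<le> l)"
  using assms
proof (induction arbitrary: P x y r rule: coned_path_length.induct)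
  case (refl p)
  then show ?case by auto
next
  case (base b q l a)
  then have "r = 0 \<and> x = a \<or> r = 1 \<and> y = a" by (auto simp: edge_point_def split: if_splits)
  then show ?case using coned_path_length.base[OF base.hyps, of a] by auto
next
  case (edge P1 x1 y1 s t q l)
  have whole: "cpl (edge_point P1 x1 y1 s) q (\<bar>s - t\<bar> + l)"
    by (rule coned_path_length.edge[OF edge.hyps])
  consider "r = 0" | "r = 1" | "0 < r" "r < 1" using edge.prems by force
  then show ?case
  proof cases
    case 1
    then show ?thesis using whole edge.prems(3) by auto
  next
    case 2
    then show ?thesis using whole edge.prems(3) by auto
  next
    case 3
    then have *: "P1 = P" "x1 = x \<and> y1 = y \<and> s = r \<or> x1 = y \<and> y1 = x \<and> s = 1 - r"
      using edge_point_inj[OF edge.prems(3)[symmetric]] E_neq edge.hyps edge.prems(1) by auto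
    \<comment> \<open>The end of the step, as a parameter in the orientation of the given
      edge.\<close>
    define t' where "t' = (if s = r \<and> x1 = x then t else 1 - t)"
    have t': "t' \<in> {0..1}" "\<bar>s - t\<bar> = \<bar>r - t'\<bar>" "edge_point P1 x1 y1 t = edge_point P x y t'"
      using * edge.hyps(3) edge_point_swap[of y x P t] E_neq[OF edge.prems(1)]
      by (auto simp: t'_def)
    show ?thesis
      using edge.IH[OF edge.prems(1) t'(1,3)] t'(2) by fastforce
  qed
qed

text \<open>Lets an induction over paths between base points treat each edge as crossed completely,
  so that no interior points occur. Moves along an edge that return to the same end are dropped,
  which only shortens the path; hence the assumption \<open>mono\<close>. The proof carries along a
  statement for paths starting inside an edge.\<close>

lemma cpl_base_induct:
  assumes path: "cpl (Base a) (Base b) l"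
    and mono: "\<And>a l l'. Q a l \<Longrightarrow> l \<le> l' \<Longrightarrow> Q a l'"
    and nil: "Q b 0"
    and dist: "\<And>x y l. Q y l \<Longrightarrow> 0 \<le> l \<Longrightarrow> Q x (dist x y + l)"
    and net: "\<And>P x y l. E P x y \<Longrightarrow> Q y l \<Longrightarrow> 0 \<le> l \<Longrightarrow> Q x (1 + l)"
  shows "Q a l"
proof -
  have "(\<forall>a. p = Base a \<longrightarrow> Q a l) \<and>
      (\<forall>P x y r. E P x y \<longrightarrow> r \<in> {0..1} \<longrightarrow> p = edge_point P x y r \<longrightarrow>
        (\<exists>l'\<ge>0. Q x l' \<and> r + l' \<le> l) \<or> (\<exists>l'\<ge>0. Q y l' \<and> 1 - r + l' \<le> l))"
    if "cpl p q l" "q = Base b" for p q l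
    using that
  proof (induction rule: coned_path_length.induct)
    case (refl p)
    then have "r = 0 \<and> x = b \<or> r = 1 \<and> y = b" if "p = edge_point P x y r" for P x y r
      using that by (auto simp: edge_point_def split: if_splits)
    then have "(\<exists>l'\<ge>0. Q x l' \<and> r + l' \<le> 0) \<or> (\<exists>l'\<ge>0. Q y l' \<and> 1 - r + l' \<le> 0)"
      if "p = edge_point P x y r" for P x y r
      using that nil by (metis add.right_neutral cancel_comm_monoid_add_class.diff_cancel order_refl)
    then show ?case using refl nil by auto
  next
    case (base y q l x)
    have l: "0 \<le> l" "Q y l" using base cpl_nonneg by auto
    then have Q: "Q x (dist x y + l)" by (intro dist)
    have "(\<exists>l'\<ge>0. Q x' l' \<and> r + l' \<le> dist x y + l) \<or> (\<exists>l'\<ge>0. Q y' l' \<and> 1 - r + l' \<le> dist x y + l)"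
      if "Base x = edge_point P x' y' r" for P x' y' r
    proof -
      have "0 \<le> dist x y + l" using l(1) by simp
      moreover have "r = 0 \<and> x' = x \<or> r = 1 \<and> y' = x"
        using that by (auto simp: edge_point_def split: if_splits)
      ultimately show ?thesis using Q by auto
    qed
    then show ?case using Q by blast
  next
    case (edge P x y s t q l)
    have l: "0 \<le> l" using cpl_nonneg edge.hyps by blast
    have neq: "x \<noteq> y" using E_neq edge.hyps by blast
    have IH: "(\<exists>l'\<ge>0. Q x l' \<and> t + l' \<le> l) \<or> (\<exists>l'\<ge>0. Q y l' \<and> 1 - t + l' \<le> l)"
      using edge by blast
    have t: "0 \<le> t" "t \<le> 1" using edge.hyps(3) by auto
    \<comment> \<open>From parameter \<open>t\<close> the path continues through one of the two
      ends. If this is \<open>y\<close>, a full crossing is added to return to \<open>x\<close>, and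
      \<open>1 + l' \<le> t + l\<close>.\<close>
    have 0: "Q x (t + l)"
      using IH
    proof (elim disjE exE conjE)
      fix l' assume "Q x l'" "t + l' \<le> l"
      then show ?thesis using t by (elim mono) simp
    next
      fix l' assume "0 \<le> l'" "Q y l'" "1 - t + l' \<le> l"
      then show ?thesis using mono[OF net[OF edge.hyps(1)]] by simp
    qed
    have 1: "Q y (1 - t + l)"
      using IH
    proof (elim disjE exE conjE)
      fix l' assume "0 \<le> l'" "Q x l'" "t + l' \<le> l"
      then show ?thesis using mono[OF net[OF E_sym[OF edge.hyps(1)]]] by simp
    next
      fix l' assume "Q y l'" "1 - t + l' \<le> l"
      then show ?thesis using t by (elim mono) simp
    qed
    have base: "Q a (\<bar>s - t\<bar> + l)" if "edge_point P x y s = Base a" for a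
      using that 0 1 edge.hyps(3) by (auto simp: edge_point_def split: if_splits)
    have "(\<exists>l'\<ge>0. Q u l' \<and> r + l' \<le> \<bar>s - t\<bar> + l) \<or> (\<exists>l'\<ge>0. Q v l' \<and> 1 - r + l' \<le> \<bar>s - t\<bar> + l)"
      if uv: "E P' u v" "r \<in> {0..1}" "edge_point P x y s = edge_point P' u v r" for P' u v r
    proof -
      consider "r = 0" | "r = 1" | "0 < r" "r < 1" using uv by force
      then show ?thesis
      proof cases
        case 1
        then show ?thesis using base[of u] uv l by (intro disjI1 exI[of _ "\<bar>s - t\<bar> + l"]) auto
      next
        case 2
        then show ?thesis using base[of v] uv l by (intro disjI2 exI[of _ "\<bar>s - t\<bar> + l"]) auto
      next
        case 3
        then have "x = u \<and> y = v \<and> s = r \<or> x = v \<and> y = u \<and> s = 1 - r"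
          using edge_point_inj[OF uv(3)[symmetric]] E_neq[OF uv(1)] neq edge.hyps by auto
        then show ?thesis
        proof (elim disjE conjE)
          assume "x = u" "y = v" "s = r"
          from IH show ?thesis unfolding \<open>x = u\<close> \<open>y = v\<close> \<open>s = r\<close>
            by (elim disjE exE conjE) (auto intro!: exI)
        next
          assume "x = v" "y = u" "s = 1 - r"
          from IH show ?thesis unfolding \<open>x = v\<close> \<open>y = u\<close> \<open>s = 1 - r\<close>
            by (elim disjE exE conjE) (auto intro!: exI)
        qed
      qed
    qed
    then show ?case using base by blast
  qed
  then show ?thesis using path by blast
qed

text \<open>A path of length below \<open>1\<close> has no room for crossing an edge.\<close>

lemma dist_le_dh:
  assumes "dh a b < 1"
  shows "dist a b \<le> dh a b"
proof (rule ccontr)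
  assume "\<not> dist a b \<le> dh a b"
  then have "dh a b < min 1 (dist a b)" using assms by simp
  then obtain l where l: "cpl (Base a) (Base b) l" "l < min 1 (dist a b)"
    by (rule cd_less[rotated 2]) auto
  have "l < 1 \<longrightarrow> dist a b \<le> l"
  proof (rule cpl_base_induct[OF l(1), of "\<lambda>a l. l < 1 \<longrightarrow> dist a b \<le> l"])
    fix x y and l :: real assume "l < 1 \<longrightarrow> dist y b \<le> l" "0 \<le> l"
    then show "dist x y + l < 1 \<longrightarrow> dist x b \<le> dist x y + l"
      using dist_triangle[of x b y] zero_le_dist[of x y] by linarith
  qed auto
  then show False using l(2) by simp
qed

text \<open>The length \<open>1/2\<close> is safely below \<open>1\<close>, the threshold under
  which coned and original distances agree.\<close>

definition step :: "'a \<Rightarrow> 'a \<Rightarrow> bool" where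
  "step x y \<longleftrightarrow> dist x y \<le> 1/2 \<or> (\<exists>P\<in>\<P>. x \<in> N P \<and> y \<in> N P)"

text \<open>Steps are counted because closeness will be logarithmic in their number;
  \<open>V\<close> confines the visited points and is the set to which a geodesic is shown to be
  close.\<close>

inductive chain :: "'a set \<Rightarrow> nat \<Rightarrow> 'a \<Rightarrow> 'a \<Rightarrow> bool" for V where
  nil: "b \<in> V \<Longrightarrow> chain V 0 b b"
| step: "x \<in> V \<Longrightarrow> step x y \<Longrightarrow> chain V n y b \<Longrightarrow> chain V (Suc n) x b"

lemma chain_append: "chain V m a b \<Longrightarrow> chain V n b c \<Longrightarrow> chain V (m + n) a c"
  by (induction rule: chain.induct) (auto intro: chain.step)

lemma chain_ends: "chain V n a b \<Longrightarrow> a \<in> V \<and> b \<in> V"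
  by (induction rule: chain.induct) auto

lemma chain_mono: "chain V n a b \<Longrightarrow> V \<subseteq> W \<Longrightarrow> chain W n a b"
  by (induction rule: chain.induct) (auto intro: chain.intros)

lemma chain_split:
  "chain V n a c \<Longrightarrow> m \<le> n \<Longrightarrow> \<exists>b. chain V m a b \<and> chain V (n - m) b c"
proof (induction arbitrary: m rule: chain.induct)
  case (nil b)
  then show ?case by (auto intro: chain.nil)
next
  case (step x y n b)
  show ?case
  proof (cases m)
    case 0
    then show ?thesis using step by (auto intro: chain.intros)
  next
    case (Suc m')
    then obtain z where "chain V m' y z" "chain V (n - m') z b" using step by fastforce
    then show ?thesis using Suc step by (auto intro: chain.step)
  qed
qed

lemma step_dh: "step x y \<Longrightarrow> dh x y \<le> 1"
  using dh_net dh_le_dist[of x y] by (auto simp: step_def)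

lemma chain_local: "chain UNIV n a b \<Longrightarrow> chain {v. dh a v \<le> n} n a b"
proof (induction rule: chain.induct)
  case (nil b)
  then show ?case by (auto intro: chain.nil)
next
  case (step x y n b)
  have "{v. dh y v \<le> n} \<subseteq> {v. dh x v \<le> Suc n}"
  proof
    fix v assume "v \<in> {v. dh y v \<le> n}"
    then show "v \<in> {v. dh x v \<le> Suc n}"
      using step_dh[OF step(2)] dh_triangle[of x v y] by simp
  qed
  then show ?case using step by (intro chain.step[OF _ step(2)] chain_mono[OF step.IH]) auto
qed

end

locale rel_hyp_coned = rel_hyp \<P> \<epsilon> M \<sigma> \<delta> B + coned \<P> N
  for \<P> :: "'a::metric_space set set" and \<epsilon> M \<sigma> \<delta> B and N +
  fixes k :: real
  assumes net: "\<And>P. P \<in> \<P> \<Longrightarrow> maximal_net k P (N P)"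
begin

section \<open>Nets, and the coned size of peripheral neighbourhoods\<close>

lemma net_subset: "P \<in> \<P> \<Longrightarrow> N P \<subseteq> P"
  using net by (auto simp: maximal_net_def)

text \<open>A point of \<open>P\<close> at distance at least \<open>k\<close> from the whole net can
  be added to it, so by maximality it is already there. The maximum with \<open>0\<close> accounts
  for a negative \<open>k\<close>.\<close>

lemma net_dense:
  assumes P: "P \<in> \<P>" and p: "p \<in> P"
  obtains n where "n \<in> N P" "dist p n \<le> max k 0"
proof (cases "\<exists>n\<in>N P. dist p n < k")
  case True
  then show ?thesis using that by force
next
  case False
  then have "pairwise (\<lambda>x y. k \<le> dist x y) (insert p (N P))"
    using net[OF P] by (auto simp: maximal_net_def pairwise_insert dist_commute not_less)
  then have "insert p (N P) = N P"
    using net[OF P] p by (auto simp: maximal_net_def)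
  then show ?thesis using that[of p] by auto
qed

text \<open>From each of two points, \<open>r + 1\<close> leads into \<open>P\<close> and
  \<open>max k 0\<close> on to its net; one edge joins the two net points.\<close>

definition hP :: "real \<Rightarrow> real" where "hP r = 2 * (r + 1 + max k 0) + 1"

lemma dh_nbhd:
  assumes P: "P \<in> \<P>" and x: "x \<in> nbhd r P" and y: "y \<in> nbhd r P"
  shows "dh x y \<le> hP r"
proof -
  have *: "\<exists>n\<in>N P. dh x n \<le> r + 1 + max k 0" if xr: "x \<in> nbhd r P" for x
  proof -
    obtain p where p: "p \<in> P" "dist x p \<le> r + 1" using nbhd_approx[OF xr] by blast
    obtain n where "n \<in> N P" "dist p n \<le> max k 0" using net_dense[OF P p(1)] by blast
    then show ?thesis
      using p dh_le_dist[of x n] dist_triangle[of x n p] by (intro bexI[of _ n]) linarith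
  qed
  obtain m n where "m \<in> N P" "dh x m \<le> r + 1 + max k 0" "n \<in> N P" "dh y n \<le> r + 1 + max k 0"
    using *[OF x] *[OF y] by blast
  then show ?thesis
    using dh_net[OF P, of m n] dh_triangle[of x y m] dh_triangle[of m y n] cd_sym[of "Base y" "Base n"]
    by (simp add: hP_def)
qed

lemma chain_of_dist: "dist x y \<le> real m / 2 \<Longrightarrow> chain UNIV m x y"
proof (induction m arbitrary: x)
  case 0
  then show ?case by (auto intro: chain.nil)
next
  case (Suc m)
  obtain L g where g: "geod x y L g" using geo by blast
  define t where "t = min (1/2) L"
  have t: "t \<in> {0..L}" "t \<le> 1/2" using geodD(1)[OF g] by (auto simp: t_def)
  have "dist (g t) y \<le> real m / 2"
    using geodD(7)[OF g t(1)] geodD(4)[OF g] Suc.prems by (auto simp: t_def min_def)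
  moreover have "step x (g t)" using geodD(6)[OF g t(1)] t(2) by (simp add: step_def)
  ultimately show ?case using Suc.IH chain.step by auto
qed

lemma chain_of_dist': "\<exists>m. real m \<le> 2 * dist x y + 1 \<and> chain UNIV m x y"
proof -
  have "dist x y \<le> real (nat \<lceil>2 * dist x y\<rceil>) / 2" "real (nat \<lceil>2 * dist x y\<rceil>) \<le> 2 * dist x y + 1"
    using zero_le_dist[of x y] by linarith+
  then show ?thesis using chain_of_dist by blast
qed

text \<open>The part in X from \<open>a\<close> to \<open>a'\<close> is kept as a length and cut
  into half-unit steps only when an edge is met. An edge, having length \<open>1\<close>, brings a
  budget of two steps: one for the jump, one for rounding that part up. The last rounding gives the
  \<open>+ 1\<close>.\<close>

lemma chain_of_dh:
  assumes "dh a b < l"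
  shows "\<exists>n. real n \<le> 2 * l + 1 \<and> chain UNIV n a b"
proof -
  obtain l' where l': "cpl (Base a) (Base b) l'" "l' < l"
    using cd_less[OF _ _ assms] by auto
  have "\<exists>n a'. chain UNIV n a' b \<and> n + 2 * dist a a' \<le> 2 * l'"
  proof (rule cpl_base_induct[OF l'(1), of "\<lambda>a l. \<exists>n a'. chain UNIV n a' b \<and> n + 2 * dist a a' \<le> 2 * l"])
    show "\<exists>n a'. chain UNIV n a' b \<and> n + 2 * dist b a' \<le> 2 * 0"
      by (intro exI[of _ 0] exI[of _ b]) (auto intro: chain.nil)
  next
    fix x y l assume "\<exists>n a'. chain UNIV n a' b \<and> n + 2 * dist y a' \<le> 2 * l"
    then obtain n a' where "chain UNIV n a' b" "n + 2 * dist y a' \<le> 2 * l" by blast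
    then show "\<exists>n a'. chain UNIV n a' b \<and> n + 2 * dist x a' \<le> 2 * (dist x y + l)"
      using dist_triangle[of x a' y] by (intro exI[of _ n] exI[of _ a']) auto
  next
    fix P x y l assume E: "E P x y" and "\<exists>n a'. chain UNIV n a' b \<and> n + 2 * dist y a' \<le> 2 * l"
    then obtain n a' where n: "chain UNIV n a' b" "n + 2 * dist y a' \<le> 2 * l" by blast
    obtain m where m: "real m \<le> 2 * dist y a' + 1" "chain UNIV m y a'" using chain_of_dist' by blast
    have "step x y" using E by (auto simp: step_def is_edge_def)
    then have "chain UNIV (Suc (m + n)) x b"
      using chain_append[OF m(2) n(1)] by (intro chain.step) auto
    then show "\<exists>n a'. chain UNIV n a' b \<and> n + 2 * dist x a' \<le> 2 * (1 + l)"
      using n(2) m(1) by (intro exI[of _ "Suc (m + n)"] exI[of _ x]) auto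
  qed fastforce
  then obtain n a' where n: "chain UNIV n a' b" "n + 2 * dist a a' \<le> 2 * l'" by blast
  obtain m where m: "real m \<le> 2 * dist a a' + 1" "chain UNIV m a a'" using chain_of_dist' by blast
  show ?thesis
    using chain_append[OF m(2) n(1)] n(2) m(1) l'(2) by (intro exI[of _ "m + n"]) auto
qed

end

section \<open>Coned thinness of geodesics\<close>

context rel_hyp_coned
begin

lemma dh_dist3: "dh a d \<le> dist a b + dh b c + dist c d"
  using dh_triangle[of a d b] dh_triangle[of b d c] dh_le_dist[of a b] dh_le_dist[of c d] by linarith

lemma dh_commute: "dh x y = dh y x"
  by (rule cd_sym)

lemma step_sym: "step x y \<Longrightarrow> step y x"
  by (auto simp: step_def dist_commute)

lemma chain_sym: "chain V n a b \<Longrightarrow> chain V n b a"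
proof (induction rule: chain.induct)
  case (nil b)
  then show ?case by (rule chain.nil)
next
  case (step x y n b)
  have "chain V 1 y x"
    using chain.step[OF _ step_sym[OF step(2)] chain.nil[OF step(1)]] chain_ends[OF step(3)] by simp
  then show ?case using chain_append[OF step.IH] by fastforce
qed

text \<open>The triangle is formed with \<open>w\<close> as a vertex, so that its two sides through \<open>w\<close> run almost
  along a geodesic and cannot come close to each other far away from \<open>w\<close>.\<close>

lemma bigon_thin:
  assumes g: "geod x a L g" and t: "t \<in> {0..L}" and g3: "geod c x L3 g3" and ac: "dist a c \<le> r"
  shows "\<exists>s\<in>{0..L3}. dh (g t) (g3 s) \<le> 2 * D + 2 * r + hP \<sigma>"
proof -
  have g1: "geod x (g t) t g"
    using geod_sub[OF g, of 0 t] t geodD(2)[OF g] by simp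
  obtain L2 g2 where g2: "geod (g t) c L2 g2" using geo by blast
  obtain e1 f1 e2 f2 e3 f3 where
    e: "0 \<le> e1" "e1 \<le> f1" "f1 \<le> t" "0 \<le> e2" "e2 \<le> f2" "f2 \<le> L2" "0 \<le> e3" "e3 \<le> f3" "f3 \<le> L3"
    and d: "dist (g f1) (g2 e2) \<le> D" "dist (g2 f2) (g3 e3) \<le> D" "dist (g3 f3) (g e1) \<le> D"
    and Q: "(e1 = f1 \<and> e2 = f2 \<and> e3 = f3) \<or> (\<exists>Q\<in>\<P>. g e1 \<in> nbhd \<sigma> Q \<and> g f1 \<in> nbhd \<sigma> Q \<and>
       g2 e2 \<in> nbhd \<sigma> Q \<and> g2 f2 \<in> nbhd \<sigma> Q \<and> g3 e3 \<in> nbhd \<sigma> Q \<and> g3 f3 \<in> nbhd \<sigma> Q)"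
    using triangle[OF g1 g2 g3] by blast
  have dists: "dist x (g f1) = f1" "dist (g t) (g2 e2) = e2" "dist (g2 e2) c = L2 - e2"
    "dist (g t) c = L2" "dist (g t) a = L - t" "dist x a = L"
    using geodD(6)[OF g, of f1] geodD(6,7)[OF g2, of e2] geodD(4)[OF g2] geodD(7)[OF g t]
      geodD(4)[OF g] e t by auto
  have "dist x a \<le> dist x c + r" "dist (g t) c \<le> dist (g t) a + r"
    using ac dist_triangle[of x a c] dist_triangle[of "g t" c a] by (simp_all add: dist_commute)
  moreover have "dist x c \<le> dist x (g f1) + dist (g f1) (g2 e2) + dist (g2 e2) c"
    using dist_triangle[of x c "g f1"] dist_triangle[of "g f1" c "g2 e2"] by linarith
  ultimately have 1: "dist (g t) (g2 e2) \<le> D + 2 * r"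
    using dists e d(1) by linarith
  have 2: "dh (g2 e2) (g2 f2) \<le> hP \<sigma>"
    using Q
  proof
    assume "e1 = f1 \<and> e2 = f2 \<and> e3 = f3"
    then show ?thesis using \<sigma>0 by (simp add: hP_def)
  qed (auto intro: dh_nbhd)
  show ?thesis
    using dh_dist3[of "g t" "g3 e3" "g2 e2" "g2 f2"] 1 2 d(2) e by (intro bexI[of _ e3]) auto
qed

text \<open>Entrance and exit points divide \<open>g1\<close> into three parts. The outer ones form
  bigons with parts of \<open>g3\<close> and \<open>g2\<close>, with ends at most \<open>D\<close>
  apart; the middle one stays near a peripheral set, so it is coned-close to \<open>g1 e1\<close>
  and hence to \<open>g3 f3\<close>.\<close>

lemma coned_thin_triangles:
  "\<exists>h. \<forall>x y z L1 g1 L2 g2 L3 g3. geod x y L1 g1 \<longrightarrow> geod y z L2 g2 \<longrightarrow> geod z x L3 g3 \<longrightarrow>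
     (\<forall>t\<in>{0..L1}. (\<exists>s\<in>{0..L2}. dh (g1 t) (g2 s) \<le> h) \<or> (\<exists>s\<in>{0..L3}. dh (g1 t) (g3 s) \<le> h))"
proof -
  define h where "h = max (2 * D + 2 * D + hP \<sigma>) (hP (qc \<sigma>) + D)"
  have "(\<exists>s\<in>{0..L2}. dh (g1 t) (g2 s) \<le> h) \<or> (\<exists>s\<in>{0..L3}. dh (g1 t) (g3 s) \<le> h)"
    if g: "geod x y L1 g1" "geod y z L2 g2" "geod z x L3 g3" and t: "t \<in> {0..L1}"
    for x y z L1 g1 L2 g2 L3 g3 t
  proof -
    obtain e1 f1 e2 f2 e3 f3 where
      e: "0 \<le> e1" "e1 \<le> f1" "f1 \<le> L1" "0 \<le> e2" "e2 \<le> f2" "f2 \<le> L2" "0 \<le> e3" "e3 \<le> f3" "f3 \<le> L3"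
      and d: "dist (g1 f1) (g2 e2) \<le> D" "dist (g2 f2) (g3 e3) \<le> D" "dist (g3 f3) (g1 e1) \<le> D"
      and Q: "(e1 = f1 \<and> e2 = f2 \<and> e3 = f3) \<or> (\<exists>Q\<in>\<P>. g1 e1 \<in> nbhd \<sigma> Q \<and> g1 f1 \<in> nbhd \<sigma> Q \<and>
         g2 e2 \<in> nbhd \<sigma> Q \<and> g2 f2 \<in> nbhd \<sigma> Q \<and> g3 e3 \<in> nbhd \<sigma> Q \<and> g3 f3 \<in> nbhd \<sigma> Q)"
      using triangle[OF g] by blast
    consider "t \<le> e1" | "f1 \<le> t" | "e1 < t" "t < f1" by linarith
    then show ?thesis
    proof cases
      case 1
      have "geod x (g1 e1) e1 g1"
        using geod_sub[OF g(1), of 0 e1] e geodD(2)[OF g(1)] by simp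
      moreover have "geod (g3 f3) x (L3 - f3) (\<lambda>s. g3 (f3 + s))"
        using geod_sub[OF g(3), of f3 L3] e geodD(3)[OF g(3)] by simp
      ultimately obtain s where "s \<in> {0..L3 - f3}" "dh (g1 t) (g3 (f3 + s)) \<le> 2 * D + 2 * D + hP \<sigma>"
        using bigon_thin[of x "g1 e1" e1 g1 t "g3 f3"] 1 t d(3) by (fastforce simp: dist_commute)
      then show ?thesis using e by (intro disjI2 bexI[of _ "f3 + s"]) (auto simp: h_def)
    next
      case 2
      have "geod y (g1 f1) (L1 - f1) (\<lambda>s. g1 (L1 - s))"
        using geod_sub[OF geod_rev[OF g(1)], of 0 "L1 - f1"] e geodD(3)[OF g(1)] by simp
      moreover have "geod (g2 e2) y e2 (\<lambda>s. g2 (e2 - s))"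
        using geod_rev[OF geod_sub[OF g(2), of 0 e2]] e geodD(2)[OF g(2)] by simp
      ultimately have "\<exists>s\<in>{0..e2}. dh (g1 (L1 - (L1 - t))) (g2 (e2 - s)) \<le> 2 * D + 2 * D + hP \<sigma>"
        using 2 t d(1) by (intro bigon_thin) auto
      then obtain s where "s \<in> {0..e2}" "dh (g1 t) (g2 (e2 - s)) \<le> 2 * D + 2 * D + hP \<sigma>" by auto
      then show ?thesis using e by (intro disjI1 bexI[of _ "e2 - s"]) (auto simp: h_def)
    next
      case 3
      then obtain Q where Q: "Q \<in> \<P>" "g1 e1 \<in> nbhd \<sigma> Q" "g1 f1 \<in> nbhd \<sigma> Q" using Q by auto
      have "g1 t \<in> nbhd (qc \<sigma>) Q"
        by (rule quasiconvex_between[OF g(1) Q(1), of e1 t f1]) (use 3 e Q in auto)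
      moreover have "g1 e1 \<in> nbhd (qc \<sigma>) Q" by (rule nbhd_mono[OF Q(2) qc_ge(1)])
      ultimately have "dh (g1 t) (g1 e1) \<le> hP (qc \<sigma>)" by (rule dh_nbhd[OF Q(1)])
      then have "dh (g1 t) (g3 f3) \<le> h"
        using d(3) dh_dist3[of "g1 t" "g3 f3" "g1 t" "g1 e1"] by (simp add: h_def dist_commute)
      then show ?thesis using e by auto
    qed
  qed
  then show ?thesis by blast
qed

text \<open>Each halving of the chain costs one thin triangle, hence one \<open>h\<close>, and after
  \<open>m\<close> halvings at most a single step remains. A geodesic over one step is either short
  or joins two points of some \<open>P\<close>, near which it stays by quasiconvexity; in both cases
  its coned size is bounded.\<close>

lemma geodesic_near_chain:
  "\<exists>h h0. 0 \<le> h \<and> (\<forall>m n V x y L g. chain V n x y \<longrightarrow> n \<le> 2 ^ m \<longrightarrow> geod x y L g \<longrightarrow>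
     (\<forall>u\<in>{0..L}. \<exists>v\<in>V. dh (g u) v \<le> h * real m + h0))"
proof -
  obtain h where thin: "\<And>x y z L1 g1 L2 g2 L3 g3 t. geod x y L1 g1 \<Longrightarrow> geod y z L2 g2 \<Longrightarrow>
     geod z x L3 g3 \<Longrightarrow> t \<in> {0..L1} \<Longrightarrow>
     (\<exists>s\<in>{0..L2}. dh (g1 t) (g2 s) \<le> h) \<or> (\<exists>s\<in>{0..L3}. dh (g1 t) (g3 s) \<le> h)"
    using coned_thin_triangles by metis
  define h0 where "h0 = max (1/2) (hP (qc 0))"
  have "\<exists>v\<in>V. dh (g u) v \<le> max h 0 * real m + h0"
    if "chain V n x y" "n \<le> 2 ^ m" "geod x y L g" "u \<in> {0..L}" for m n V x y L g u
    using that
  proof (induction m arbitrary: n x y L g u)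
    case 0
    have xV: "x \<in> V" using chain_ends[OF 0(1)] by blast
    have "dh (g u) x \<le> h0"
    proof (cases n)
      case 0
      then have "x = y" using \<open>chain V n x y\<close> by (auto elim: chain.cases)
      then have "L = 0" using geodD(4)[OF \<open>geod x y L g\<close>] by simp
      then show ?thesis using geodD(2)[OF \<open>geod x y L g\<close>] \<open>u \<in> {0..L}\<close> by (simp add: h0_def)
    next
      case (Suc n')
      then have "n = 1" using \<open>n \<le> 2 ^ 0\<close> by simp
      then have "step x y" using 0(1) by (auto elim!: chain.cases)
      then show ?thesis unfolding step_def
      proof
        assume "dist x y \<le> 1 / 2"
        then show ?thesis
          using dh_le_dist[of "g u" x] geodD(4)[OF 0(3)] geodD(6)[OF 0(3,4)] 0(4)
          by (auto simp: h0_def dist_commute)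
      next
        assume "\<exists>P\<in>\<P>. x \<in> N P \<and> y \<in> N P"
        then obtain P where P: "P \<in> \<P>" "x \<in> N P" "y \<in> N P" by blast
        then have xy: "x \<in> nbhd 0 P" "y \<in> nbhd 0 P" using net_subset by (auto intro: nbhd_mem)
        then have "dh (g u) x \<le> hP (qc 0)"
          by (intro dh_nbhd[OF P(1)] quasiconvex[OF 0(3) P(1) xy 0(4)] nbhd_mono[OF xy(1) qc_ge(1)])
        then show ?thesis by (simp add: h0_def)
      qed
    qed
    then show ?case using xV by auto
  next
    case (Suc m)
    define i where "i = min n (2 ^ m)"
    have i: "i \<le> n" "i \<le> 2 ^ m" "n - i \<le> 2 ^ m" using Suc.prems(2) by (auto simp: i_def)
    obtain z where z: "chain V i x z" "chain V (n - i) z y"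
      using chain_split[OF Suc.prems(1) i(1)] by blast
    obtain L2 g2 where g2: "geod y z L2 g2" using geo by blast
    obtain L3 g3 where g3: "geod z x L3 g3" using geo by blast
    have "\<exists>w. dh (g u) w \<le> max h 0 \<and> (\<exists>v\<in>V. dh w v \<le> max h 0 * real m + h0)"
      using thin[OF Suc.prems(3) g2 g3 Suc.prems(4)]
    proof (elim disjE bexE)
      fix s assume s: "s \<in> {0..L2}" "dh (g u) (g2 s) \<le> h"
      have "\<exists>v\<in>V. dh (g2 (L2 - (L2 - s))) v \<le> max h 0 * real m + h0"
        by (rule Suc.IH[OF z(2) i(3) geod_rev[OF g2]]) (use s in auto)
      then show ?thesis using s by (intro exI[of _ "g2 s"]) auto
    next
      fix s assume s: "s \<in> {0..L3}" "dh (g u) (g3 s) \<le> h"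
      have "\<exists>v\<in>V. dh (g3 (L3 - (L3 - s))) v \<le> max h 0 * real m + h0"
        by (rule Suc.IH[OF z(1) i(2) geod_rev[OF g3]]) (use s in auto)
      then show ?thesis using s by (intro exI[of _ "g3 s"]) auto
    qed
    then obtain w v where w: "dh (g u) w \<le> max h 0" "v \<in> V" "dh w v \<le> max h 0 * real m + h0" by blast
    then have "dh (g u) v \<le> max h 0 * real (Suc m) + h0"
      using dh_triangle[of "g u" v w] by (simp add: algebra_simps)
    then show ?case using w(2) by blast
  qed
  then show ?thesis by (intro exI[of _ "max h 0"] exI[of _ h0]) auto
qed

text \<open>Let \<open>w\<close> on \<open>g\<close> be almost farthest from the points
  \<open>b t\<close>, at coned distance about \<open>d\<close>. A detour that leaves
  \<open>g\<close> on both sides of \<open>w\<close> and follows these points has a number of steps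
  linear in \<open>d\<close> and stays almost \<open>d\<close> away from \<open>w\<close>, yet it
  must pass \<open>w\<close> at a distance logarithmic in \<open>d\<close>. So \<open>d\<close> is
  bounded.\<close>

lemma geodesic_near_coned_geodesic:
  "\<exists>H\<ge>0. \<forall>(b :: real \<Rightarrow> 'a) T t1 t2 L g. t1 \<in> T \<longrightarrow> t2 \<in> T \<longrightarrow>
     (\<forall>s\<in>T. \<forall>t\<in>T. dh (b s) (b t) = \<bar>s - t\<bar>) \<longrightarrow>
     (\<forall>s\<in>T. \<forall>t\<in>T. \<exists>n. real n \<le> 2 * \<bar>s - t\<bar> + 2 \<and> chain (b ` T) n (b s) (b t)) \<longrightarrow>
     geod (b t1) (b t2) L g \<longrightarrow> (\<forall>u\<in>{0..L}. \<exists>t\<in>T. dh (g u) (b t) \<le> H)"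
proof -
  obtain h h0 where h: "0 \<le> h" and near: "\<And>m n V x y L g u. chain V n x y \<Longrightarrow> n \<le> 2 ^ m \<Longrightarrow>
      geod x y L g \<Longrightarrow> u \<in> {0..L} \<Longrightarrow> \<exists>v\<in>V. dh (g u) v \<le> h * real m + h0"
    using geodesic_near_chain by metis
  \<comment> \<open>The number \<open>20 * d + 32\<close> bounds the steps of the detour built
    below; the \<open>1\<close> added to the logarithm pays for rounding it up.\<close>
  have "eventually (\<lambda>d. h * (log 2 (20 * real d + 32) + 1) + h0 < real d - 1) sequentially"
    by real_asymp
  then obtain d0 :: nat where d0: "\<And>d. d0 \<le> d \<Longrightarrow> h * (log 2 (20 * real d + 32) + 1) + h0 < real d - 1"
    by (auto simp: eventually_sequentially)
  have "\<exists>t\<in>T. dh (g u) (b t) \<le> real d0"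
    if t12: "t1 \<in> T" "t2 \<in> T" and iso: "\<And>s t. s \<in> T \<Longrightarrow> t \<in> T \<Longrightarrow> dh (b s) (b t) = \<bar>s - t\<bar>"
      and ch: "\<And>s t. s \<in> T \<Longrightarrow> t \<in> T \<Longrightarrow>
        \<exists>n. real n \<le> 2 * \<bar>s - t\<bar> + 2 \<and> chain (b ` T) n (b s) (b t)"
      and g: "geod (b t1) (b t2) L g" and u: "u \<in> {0..L}"
    for b :: "real \<Rightarrow> 'a" and T t1 t2 L g u
  proof -
    define R where "R d \<longleftrightarrow> (\<forall>u\<in>{0..L}. \<exists>t\<in>T. dh (g u) (b t) \<le> real d)" for d
    have "R (nat \<lceil>L\<rceil>)" unfolding R_def
    proof
      fix u assume "u \<in> {0..L}"
      then have "dh (g u) (b t1) \<le> real (nat \<lceil>L\<rceil>)"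
        using dh_le_dist[of "g u" "b t1"] geodD(6)[OF g, of u] by (simp add: dist_commute) linarith
      then show "\<exists>t\<in>T. dh (g u) (b t) \<le> real (nat \<lceil>L\<rceil>)" using t12 by blast
    qed
    \<comment> \<open>A least integer bound replaces the supremum: some point then has distance
      above \<open>d - 1\<close>, whether or not a maximum is attained.\<close>
    define d where "d = (LEAST d. R d)"
    have d: "R d" unfolding d_def by (rule LeastI) fact
    have "d \<le> d0"
    proof (rule ccontr)
      assume "\<not> d \<le> d0"
      then have dd: "d0 \<le> d" "d \<noteq> 0" by auto
      have "\<not> R (d - 1)" using dd(2) unfolding d_def by (intro not_less_Least) auto
      then obtain u where u: "u \<in> {0..L}" "\<And>t. t \<in> T \<Longrightarrow> real d - 1 < dh (g u) (b t)"
        using dd(2) by (auto simp: R_def not_le of_nat_diff)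
      define w where "w = g u"
      \<comment> \<open>On either side of \<open>w\<close>, walk along the geodesic to coned
        distance \<open>3 * d + 5\<close>, or to the end if that is no farther away, and then jump
        to some \<open>b t\<close>. A jump takes at most \<open>2 * d + 3\<close> steps, so it stays
        more than \<open>d - 1\<close> away from \<open>w\<close>.\<close>
      have side: "\<exists>v\<in>{0..l}. \<exists>t\<in>T. \<exists>n V. chain V n (p v) (b t) \<and> real n \<le> 2 * real d + 5 \<and>
          (\<forall>z\<in>V. real d - 1 < dh w z) \<and> dh w (p v) \<le> 3 * real d + 5 \<and> dh (p v) (b t) \<le> real d"
        if p: "geod (b s) w l p" and s: "s \<in> T" and pR: "\<And>v. v \<in> {0..l} \<Longrightarrow> \<exists>t\<in>T. dh (p v) (b t) \<le> real d"
        for p l s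
      proof (cases "dh w (b s) \<le> 3 * real d + 5")
        case True
        have "chain {b s} 0 (p 0) (b s)" using geodD(2)[OF p] by (auto intro: chain.nil)
        then show ?thesis
          using True s u(2)[OF s] geodD(1,2)[OF p] unfolding w_def[symmetric]
          by (intro bexI[of _ 0] bexI[of _ s] exI[of _ "0::nat"] exI[of _ "{b s}"]) auto
      next
        case False
        have "1-lipschitz_on {0..l} (\<lambda>v. dh w (p v))"
        proof (rule lipschitz_onI)
          fix v v' assume v: "v \<in> {0..l}" "v' \<in> {0..l}"
          have "dh w (p v) \<le> dh w (p v') + dist (p v) (p v')" "dh w (p v') \<le> dh w (p v) + dist (p v) (p v')"
            using dh_triangle[of w "p v" "p v'"] dh_triangle[of w "p v'" "p v"] dh_le_dist[of "p v" "p v'"]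
              dh_le_dist[of "p v'" "p v"] by (simp_all add: dist_commute)
          then show "dist (dh w (p v)) (dh w (p v')) \<le> 1 * dist v v'"
            using geodD(5)[OF p v] by (simp add: dist_real_def)
        qed simp
        then have "continuous_on {0..l} (\<lambda>v. dh w (p v))" by (rule lipschitz_on_continuous_on)
        then obtain v where v: "0 \<le> v" "v \<le> l" "dh w (p v) = 3 * real d + 5"
          using IVT2'[of "\<lambda>v. dh w (p v)" l "3 * real d + 5" 0] False geodD(1-3)[OF p] by auto
        obtain t where t: "t \<in> T" "dh (p v) (b t) \<le> real d" using pR[of v] v by auto
        then obtain n where n: "real n \<le> 2 * (real d + 1) + 1" "chain UNIV n (p v) (b t)"
          using chain_of_dh[of "p v" "b t" "real d + 1"] by auto
        have "real d - 1 < dh w z" if "dh (p v) z \<le> real n" for z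
        proof -
          have "3 * real d + 5 - real n \<le> dh w z"
            using dh_triangle[of w "p v" z] dh_commute[of z "p v"] that v(3) by simp
          then show ?thesis using n(1) by simp
        qed
        then show ?thesis
          using chain_local[OF n(2)] n(1) t v
          by (intro bexI[of _ v] bexI[of _ t] exI[of _ n] exI[of _ "{z. dh (p v) z \<le> real n}"]) auto
      qed
      have "geod (b t1) w u g"
        using geod_sub[OF g, of 0 u] u(1) geodD(2)[OF g] by (simp add: w_def)
      then obtain ua ta na Va where a: "ua \<in> {0..u}" "ta \<in> T" "chain Va na (g ua) (b ta)"
        "real na \<le> 2 * real d + 5" "\<And>z. z \<in> Va \<Longrightarrow> real d - 1 < dh w z" "dh w (g ua) \<le> 3 * real d + 5"
        "dh (g ua) (b ta) \<le> real d"
        using side[of t1 u g] t12 d u(1) unfolding R_def by fastforce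
      have "geod (b t2) w (L - u) (\<lambda>v. g (L - v))"
        using geod_sub[OF geod_rev[OF g], of 0 "L - u"] u(1) geodD(3)[OF g] by (simp add: w_def)
      moreover have "\<exists>t\<in>T. dh (g (L - v)) (b t) \<le> real d" if "v \<in> {0..L - u}" for v
        using d that u(1) unfolding R_def by auto
      ultimately obtain v tb nb Vb where b: "v \<in> {0..L - u}" "tb \<in> T" "chain Vb nb (g (L - v)) (b tb)"
        "real nb \<le> 2 * real d + 5" "\<And>z. z \<in> Vb \<Longrightarrow> real d - 1 < dh w z" "dh w (g (L - v)) \<le> 3 * real d + 5"
        "dh (g (L - v)) (b tb) \<le> real d"
        using side[of t2 "L - u" "\<lambda>v. g (L - v)"] t12(2) by blast
      obtain n where n: "real n \<le> 2 * \<bar>ta - tb\<bar> + 2" "chain (b ` T) n (b ta) (b tb)"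
        using ch[OF a(2) b(2)] by blast
      \<comment> \<open>Two jumps of coned length at most \<open>d\<close> and two walks to distance
        at most \<open>3 * d + 5\<close>.\<close>
      have "\<bar>ta - tb\<bar> \<le> 8 * real d + 10"
        using iso[OF a(2) b(2)] dh_triangle[of "b ta" "b tb" "g ua"] dh_triangle[of "g ua" "b tb" w]
          dh_triangle[of w "b tb" "g (L - v)"] a(6,7) b(6,7) dh_commute[of "b ta" "g ua"]
          dh_commute[of "g ua" w] by linarith
      then have N: "real (na + n + nb) \<le> 20 * real d + 32" using a(4) b(4) n(1) by simp
      let ?V = "Va \<union> b ` T \<union> Vb"
      have chain: "chain ?V (na + n + nb) (g ua) (g (L - v))"
        by (intro chain_append[where b = "b tb"] chain_append[where b = "b ta"])
          (use a(3) n(2) chain_sym[OF b(3)] in \<open>auto elim: chain_mono\<close>)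
      define m where "m = nat \<lceil>log 2 (20 * real d + 32)\<rceil>"
      have m: "real m \<le> log 2 (20 * real d + 32) + 1" "log 2 (20 * real d + 32) \<le> real m"
      proof -
        have "0 \<le> log 2 (20 * real d + 32)" by simp
        then show "real m \<le> log 2 (20 * real d + 32) + 1" "log 2 (20 * real d + 32) \<le> real m"
          unfolding m_def by linarith+
      qed
      then have "20 * real d + 32 \<le> 2 ^ m"
        using log_le_iff[of 2 "20 * real d + 32" "real m"] by (simp add: powr_realpow)
      then have "real (na + n + nb) \<le> real (2 ^ m)" using N by simp
      then have le: "na + n + nb \<le> 2 ^ m" by (simp only: of_nat_le_iff)
      have "geod (g ua) (g (L - v)) (L - v - ua) (\<lambda>s. g (ua + s))"
        by (rule geod_sub[OF g]) (use a(1) b(1) u(1) in auto)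
      from near[OF chain le this, of "u - ua"] obtain z where
        z: "z \<in> ?V" "dh w z \<le> h * real m + h0"
        using a(1) b(1) by (auto simp: w_def)
      have "h * real m + h0 < real d - 1"
        using d0[OF dd(1)] mult_left_mono[OF m(1) h] by linarith
      then have "dh w z < real d - 1" using z(2) by simp
      moreover have "real d - 1 < dh w z" using z(1) a(5) b(5) u(2) by (auto simp: w_def)
      ultimately show False by simp
    qed
    obtain t where "t \<in> T" "dh (g u) (b t) \<le> real d" using d u unfolding R_def by blast
    then show ?thesis using \<open>d \<le> d0\<close> by (intro bexI[of _ t]) auto
  qed
  then show ?thesis by (intro exI[of _ "real d0"]) auto
qed

end

section \<open>Coned-off geodesics with endpoints in the base\<close>

context coned
begin

text \<open>Every path to a base point leaves the edge through an endpoint, so none can be shorter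
  than both routes.\<close>

lemma base_escape:
  assumes e: "E P x y" and r: "r \<in> {0..1}"
  shows "r + dh x c \<le> cd (edge_point P x y r) (Base c) \<or> 1 - r + dh y c \<le> cd (edge_point P x y r) (Base c)"
proof (rule ccontr)
  assume *: "\<not> ?thesis"
  obtain l where l: "cpl (edge_point P x y r) (Base c) l" "l < min (r + dh x c) (1 - r + dh y c)"
    using cd_less[OF edge_mem[OF e r] Base_mem, of c "min (r + dh x c) (1 - r + dh y c)"] * by auto
  have "\<not> (\<exists>s\<in>{0..1}. Base c = edge_point P x y s \<and> \<bar>r - s\<bar> \<le> l)"
  proof
    assume "\<exists>s\<in>{0..1}. Base c = edge_point P x y s \<and> \<bar>r - s\<bar> \<le> l"
    then have "c = x \<and> r \<le> l \<or> c = y \<and> 1 - r \<le> l"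
      using r by (auto simp: edge_point_def split: if_splits)
    then show False using l(2) by auto
  qed
  then have "(\<exists>l'. cpl (Base x) (Base c) l' \<and> r + l' \<le> l) \<or> (\<exists>l'. cpl (Base y) (Base c) l' \<and> 1 - r + l' \<le> l)"
    using cpl_escape[OF l(1) e r HOL.refl] by blast
  then have "r + dh x c \<le> l \<or> 1 - r + dh y c \<le> l" using cd_le by fastforce
  then show False using l(2) by auto
qed

lemma edge_escape:
  assumes e: "E P x y" and r: "r \<in> {0..1}" and q: "q \<in> coned_off \<P> N"
    and off: "\<not> (\<exists>s\<in>{0..1}. q = edge_point P x y s)"
  shows "r + cd (Base x) q \<le> cd (edge_point P x y r) q \<or> 1 - r + cd (Base y) q \<le> cd (edge_point P x y r) q"
proof (rule ccontr)
  assume *: "\<not> ?thesis"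
  obtain l where l: "cpl (edge_point P x y r) q l" "l < min (r + cd (Base x) q) (1 - r + cd (Base y) q)"
    using cd_less[OF edge_mem[OF e r] q, of "min (r + cd (Base x) q) (1 - r + cd (Base y) q)"] * by auto
  have "(\<exists>l'. cpl (Base x) q l' \<and> r + l' \<le> l) \<or> (\<exists>l'. cpl (Base y) q l' \<and> 1 - r + l' \<le> l)"
    using cpl_escape[OF l(1) e r HOL.refl] off by blast
  then have "r + cd (Base x) q \<le> l \<or> 1 - r + cd (Base y) q \<le> l" using cd_le by fastforce
  then show False using l(2) by auto
qed

lemma coned_off_cases:
  assumes "p \<in> coned_off \<P> N"
  obtains x where "p = Base x" | P x y r where "E P x y" "0 < r" "r < 1" "p = edge_point P x y r"
proof -
  consider x where "p = Base x" | P x y r where "E P x y" "r \<in> {0..1}" "p = edge_point P x y r"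
    using assms unfolding coned_off_def by blast
  then show ?thesis
  proof cases
    case (2 P x y r)
    show ?thesis
    proof (cases "r = 0 \<or> r = 1")
      case True
      then show ?thesis using 2 that(1) by auto
    next
      case False
      then show ?thesis using 2 that(2)[of P x y r] by auto
    qed
  qed (use that in blast)
qed

lemma cd_eq_0_Base:
  assumes q: "q \<in> coned_off \<P> N" and "cd (Base x) q \<le> 0"
  shows "q = Base x"
  using q
proof (cases rule: coned_off_cases)
  case (1 c)
  then have "dh x c \<le> 0" using assms(2) by simp
  then have "dist x c \<le> 0" using dist_le_dh[of x c] by linarith
  then show ?thesis using 1 by simp
next
  case (2 P u v r)
  then have "r + dh u x \<le> 0 \<or> 1 - r + dh v x \<le> 0"
    using base_escape[OF 2(1), of r x] assms(2) cd_sym[of "Base x" q] by auto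
  then show ?thesis using 2(2,3) dh_nonneg[of u x] dh_nonneg[of v x] by linarith
qed

end

section \<open>Base times and components of a coned-off geodesic\<close>

locale coned_geodesic = coned \<P> N
  for \<P> :: "'a::metric_space set set" and N +
  fixes L :: real and \<gamma> :: "real \<Rightarrow> 'a cone_point"
  assumes path: "geodesic_path (coned_off \<P> N) cd L \<gamma>"
    and ends: "\<gamma> 0 \<in> range Base" "\<gamma> L \<in> range Base"
begin

definition "S = component_starts \<P> N L \<gamma>"

definition "T = {t\<in>{0..L}. \<gamma> t \<in> range Base}"

text \<open>Meaningful only at times in \<open>T\<close>, where \<open>inv Base\<close> recovers the
  point of X.\<close>

definition b :: "real \<Rightarrow> 'a" where "b t = inv Base (\<gamma> t)"

lemma L0: "0 \<le> L"
  and \<gamma>_mem: "t \<in> {0..L} \<Longrightarrow> \<gamma> t \<in> coned_off \<P> N"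
  and \<gamma>_cd: "s \<in> {0..L} \<Longrightarrow> t \<in> {0..L} \<Longrightarrow> cd (\<gamma> s) (\<gamma> t) = \<bar>s - t\<bar>"
  using path unfolding geodesic_path_def by blast+

lemma T_ends [simp]: "0 \<in> T" "L \<in> T"
  using ends L0 by (auto simp: T_def)

lemma T_le: "t \<in> T \<Longrightarrow> t \<in> {0..L}"
  by (simp add: T_def)

lemma Base_b: "t \<in> T \<Longrightarrow> Base (b t) = \<gamma> t"
  by (simp add: T_def b_def f_inv_into_f)

lemma b_dh: "s \<in> T \<Longrightarrow> t \<in> T \<Longrightarrow> dh (b s) (b t) = \<bar>s - t\<bar>"
  using \<gamma>_cd T_le by (simp add: Base_b)

lemma b_dist: "s \<in> T \<Longrightarrow> t \<in> T \<Longrightarrow> \<bar>s - t\<bar> < 1 \<Longrightarrow> dist (b s) (b t) \<le> \<bar>s - t\<bar>"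
  using dist_le_dh[of "b s" "b t"] b_dh by simp

lemma S_component:
  assumes "s \<in> S"
  obtains P where "E P (b s) (b (s + 1))" "s \<in> T" "s + 1 \<in> T"
proof -
  obtain P x y where s: "0 \<le> s" "s + 1 \<le> L" "E P x y" "\<And>r. r \<in> {0..1} \<Longrightarrow> \<gamma> (s + r) = edge_point P x y r"
    using assms unfolding S_def component_starts_def by blast
  have *: "\<gamma> s = Base x" "\<gamma> (s + 1) = Base y" using s(4)[of 0] s(4)[of 1] by auto
  then have T: "s \<in> T" "s + 1 \<in> T" using s by (auto simp: T_def)
  have "b s = x" "b (s + 1) = y" using Base_b[OF T(1)] Base_b[OF T(2)] * by auto
  then show ?thesis using that s(3) T by blast
qed

lemma S_T: "s \<in> S \<Longrightarrow> s \<in> T" "s \<in> S \<Longrightarrow> s + 1 \<in> T"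
  by (auto elim: S_component)

lemma S_open: "s \<in> S \<Longrightarrow> s < t \<Longrightarrow> t < s + 1 \<Longrightarrow> t \<notin> T"
proof
  assume s: "s \<in> S" "s < t" "t < s + 1" and t: "t \<in> T"
  obtain P x y where "E P x y" "\<And>r. r \<in> {0..1} \<Longrightarrow> \<gamma> (s + r) = edge_point P x y r"
    using s(1) unfolding S_def component_starts_def by blast
  then have "\<gamma> t = edge_point P x y (t - s)" using s by (metis add.commute atLeastAtMost_iff
    diff_add_cancel diff_ge_0_iff_ge diff_le_eq less_eq_real_def)
  then show False using t s by (auto simp: T_def edge_point_def)
qed

lemma S_separated: "s \<in> S \<Longrightarrow> s' \<in> S \<Longrightarrow> s < s' \<Longrightarrow> s + 1 \<le> s'"
  using S_open[of s s'] S_T by force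

text \<open>The ways from \<open>\<gamma> t\<close> to the two ends of \<gamma> leave its edge at
  opposite ends, since using \<open>x\<close> for both would bring the ends of \<gamma> closer than
  \<open>L\<close>. The distances to both ends then determine \<gamma> along the whole edge.\<close>

lemma not_T_component:
  assumes t: "t \<in> {0..L}" and nT: "t \<notin> T"
  obtains s where "s \<in> S" "s < t" "t < s + 1"
proof -
  define c0 cL where "c0 = b 0" and "cL = b L"
  have c: "\<gamma> 0 = Base c0" "\<gamma> L = Base cL" by (simp_all add: c0_def cL_def Base_b)
  have dc0: "cd (\<gamma> u) (Base c0) = u" and dcL: "cd (\<gamma> u) (Base cL) = L - u" if "u \<in> {0..L}" for u
    using \<gamma>_cd[OF that, of 0] \<gamma>_cd[OF that, of L] that L0 by (auto simp: c)
  have nB: "\<gamma> t \<noteq> Base x" for x using nT t by (auto simp: T_def)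
  obtain P x' y' r' where e': "E P x' y'" "0 < r'" "r' < 1" "\<gamma> t = edge_point P x' y' r'"
    using coned_off_cases[OF \<gamma>_mem[OF t]] nB by metis
  \<comment> \<open>Orient the edge so that \<open>x\<close> is the end on the way back to
    \<open>c0\<close>.\<close>
  have "\<exists>x y r. E P x y \<and> 0 < r \<and> r < 1 \<and> \<gamma> t = edge_point P x y r \<and> r + dh x c0 \<le> t"
  proof (cases "r' + dh x' c0 \<le> t")
    case True
    then show ?thesis using e' by blast
  next
    case False
    then have "(1 - r') + dh y' c0 \<le> t"
      using base_escape[OF e'(1), of r' c0] e' dc0[OF t] by auto
    moreover have "\<gamma> t = edge_point P y' x' (1 - r')"
      using e'(4) edge_point_swap[OF E_neq[OF e'(1)]] by metis
    ultimately show ?thesis using E_sym[OF e'(1)] e'(2,3)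
      by (intro exI[of _ y'] exI[of _ x'] exI[of _ "1 - r'"]) auto
  qed
  then obtain x y r where e: "E P x y" and r: "0 < r" "r < 1" and \<gamma>t: "\<gamma> t = edge_point P x y r"
    and x: "r + dh x c0 \<le> t" by blast
  have y: "1 - r + dh y cL \<le> L - t"
  proof (rule ccontr)
    assume "\<not> ?thesis"
    then have "r + dh x cL \<le> L - t"
      using base_escape[OF e, of r cL] r dcL[OF t] \<gamma>t by auto
    moreover have "dh c0 cL = L" using dc0[of L] L0 cd_sym[of "Base c0"] by (simp add: c)
    ultimately show False using dh_triangle[of c0 cL x] x r cd_sym[of "Base c0" "Base x"] by linarith
  qed
  define s where "s = t - r"
  have s: "0 \<le> s" "s + 1 \<le> L" using x y dh_nonneg[of x c0] dh_nonneg[of y cL] unfolding s_def by linarith+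
  have "\<gamma> (s + u) = edge_point P x y u" if u: "u \<in> {0..1}" for u
  proof -
    define q where "q = \<gamma> (s + u)"
    have su: "s + u \<in> {0..L}" using s u by auto
    have q: "q \<in> coned_off \<P> N" "cd q (Base c0) = s + u" "cd q (Base cL) = L - (s + u)"
      using \<gamma>_mem[OF su] dc0[OF su] dcL[OF su] by (auto simp: q_def)
    have tq: "cd (edge_point P x y r) q = \<bar>r - u\<bar>"
      using \<gamma>_cd[OF t su] by (simp add: q_def \<gamma>t s_def)
    have q0: "s + u \<le> cd (Base x) q + dh x c0" and qL: "L - (s + u) \<le> cd (Base y) q + dh y cL"
      using cd_triangle[OF q(1) Base_mem[of x] Base_mem[of c0]] cd_sym[of q "Base x"]
        cd_triangle[OF q(1) Base_mem[of y] Base_mem[of cL]] cd_sym[of q "Base y"] q(2,3) by auto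
    \<comment> \<open>Off the edge, \<open>q\<close> would be reached through \<open>x\<close> or
      \<open>y\<close> within \<open>\<bar>r - u\<bar>\<close>. The end in its direction leaves no
      positive length over, and the other one brings \<open>q\<close> too close to an end of
      \<gamma>.\<close>
    have "\<exists>v\<in>{0..1}. q = edge_point P x y v"
    proof (rule ccontr)
      assume off: "\<not> ?thesis"
      then have nq: "q \<noteq> Base x" "q \<noteq> Base y"
        by (metis atLeastAtMost_iff edge_point_0 order_refl zero_le_one,
            metis atLeastAtMost_iff edge_point_1 order_refl zero_le_one)
      then have pos: "0 < cd (Base x) q" "0 < cd (Base y) q"
        using cd_eq_0_Base[OF q(1)] by (auto simp: not_le[symmetric])
      have "r + cd (Base x) q \<le> \<bar>r - u\<bar> \<or> 1 - r + cd (Base y) q \<le> \<bar>r - u\<bar>"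
        using edge_escape[OF e _ q(1) off, of r] r tq by auto
      then show False
        using pos q0 qL x y r u unfolding s_def by (cases "u \<le> r") auto
    qed
    then obtain v where v: "v \<in> {0..1}" "q = edge_point P x y v" by blast
    have "cd (Base x) q \<le> v" "cd (Base y) q \<le> 1 - v"
      using cd_edge[OF e, of 0 v] cd_edge[OF e, of 1 v] v by auto
    then have "u = v" using q0 qL x y unfolding s_def by linarith
    then show ?thesis using v by (simp add: q_def)
  qed
  then have "s \<in> S" unfolding S_def component_starts_def using s e by blast
  then show ?thesis using that[of s] r by (simp add: s_def)
qed

text \<open>A missing time lies in a component, which has length \<open>1\<close> and would have to
  fit between \<open>t1\<close> and \<open>t2\<close>.\<close>

lemma T_interval:
  assumes "t1 \<in> T" "t2 \<in> T" "t2 < t1 + 1" "t1 \<le> t" "t \<le> t2"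
  shows "t \<in> T"
proof (rule ccontr)
  assume "t \<notin> T"
  then obtain s where s: "s \<in> S" "s < t" "t < s + 1"
    using not_T_component[of t] T_le[OF assms(1)] T_le[OF assms(2)] assms(4,5) by auto
  then have "t1 \<le> s" "s + 1 \<le> t2" using S_open[OF s(1), of t1] S_open[OF s(1), of t2] assms by force+
  then show False using assms(3) by simp
qed

text \<open>A way to traverse \<open>T\<close>, which need not be an interval: a half step if it
  ends in \<open>T\<close>, and otherwise a move over the component containing
  \<open>t + 1/2\<close>. Each move advances by at least \<open>1/2\<close>. It stops once less than
  \<open>1\<close> is left, a stretch without components.\<close>

lemma T_induct:
  assumes t: "t1 \<in> T" "t2 \<in> T" "t1 \<le> t2" and init: "Q t1"
    and half: "\<And>t. t \<in> T \<Longrightarrow> t + 1/2 \<in> T \<Longrightarrow> t1 \<le> t \<Longrightarrow> t + 1/2 \<le> t2 \<Longrightarrow> Q t \<Longrightarrow> Q (t + 1/2)"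
    and comp: "\<And>t s. t \<in> T \<Longrightarrow> s \<in> S \<Longrightarrow> t1 \<le> t \<Longrightarrow> t \<le> s \<Longrightarrow> s < t + 1/2 \<Longrightarrow> s + 1 \<le> t2 \<Longrightarrow> Q t \<Longrightarrow> Q (s + 1)"
    and last: "\<And>t. t \<in> T \<Longrightarrow> t1 \<le> t \<Longrightarrow> t \<le> t2 \<Longrightarrow> t2 < t + 1 \<Longrightarrow> Q t \<Longrightarrow> R"
  shows R
proof -
  have "R" if "t2 - t < real n / 2" "t \<in> T" "t1 \<le> t" "t \<le> t2" "Q t" for n t
    using that
  proof (induction n arbitrary: t)
    case (Suc n)
    show ?case
    proof (cases "t2 < t + 1")
      case True
      then show ?thesis using last Suc.prems by blast
    next
      case False
      show ?thesis
      proof (cases "t + 1/2 \<in> T")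
        case True
        then show ?thesis
          using Suc.IH[of "t + 1/2"] half[of t] Suc.prems False by auto
      next
        case nT: False
        then obtain s where s: "s \<in> S" "s < t + 1/2" "t + 1/2 < s + 1"
          using not_T_component[of "t + 1/2"] T_le[OF Suc.prems(2)] T_le[OF t(2)] False by auto
        have 1: "t \<le> s" using S_open[OF s(1), of t] s Suc.prems(2) by force
        have 2: "s + 1 \<le> t2" using S_open[OF s(1), of t2] s t(2) False by force
        show ?thesis
          using Suc.IH[of "s + 1"] comp[of t s] Suc.prems s 1 2 S_T(2)[OF s(1)] by auto
      qed
    qed
  qed simp
  moreover obtain n :: nat where "2 * (t2 - t1) < real n" using reals_Archimedean2 by blast
  then have "t2 - t1 < real n / 2" by simp
  ultimately show ?thesis using t init by blast
qed

lemma step_comp: "s \<in> S \<Longrightarrow> step (b s) (b (s + 1))"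
  by (elim S_component) (auto simp: step_def is_edge_def)

lemma step_short: "s \<in> T \<Longrightarrow> t \<in> T \<Longrightarrow> \<bar>s - t\<bar> \<le> 1/2 \<Longrightarrow> step (b s) (b t)"
  using b_dist[of s t] by (simp add: step_def)

text \<open>A half step uses one step of the chain, and a component with the short move before it
  uses two, so at most two steps are spent per unit of time. The remainder is split at its midpoint,
  which gives the \<open>+ 2\<close>.\<close>

lemma chain_b:
  assumes t: "t1 \<in> T" "t2 \<in> T" "t1 \<le> t2" and V: "T \<inter> {t1..t2} \<subseteq> W"
  shows "\<exists>n. real n \<le> 2 * (t2 - t1) + 2 \<and> chain (b ` W) n (b t1) (b t2)"
proof -
  let ?V = "b ` W"
  have in_V: "b t \<in> ?V" if "t \<in> T" "t1 \<le> t" "t \<le> t2" for t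
    using that V by auto
  have ext: "chain ?V (Suc n) (b t1) (b t')"
    if "chain ?V n (b t1) (b t)" "step (b t) (b t')" "t' \<in> T" "t1 \<le> t'" "t' \<le> t2" for n t t'
    using chain_append[OF that(1) chain.step[OF _ that(2) chain.nil[OF in_V[OF that(3-5)]]]]
      chain_ends[OF that(1)] by simp
  show ?thesis
  proof (rule T_induct[OF t, of "\<lambda>t. \<exists>n. real n \<le> 2 * (t - t1) \<and> chain ?V n (b t1) (b t)"])
    show "\<exists>n. real n \<le> 2 * (t1 - t1) \<and> chain ?V n (b t1) (b t1)"
      using in_V[OF t(1)] t by (intro exI[of _ 0]) (auto intro: chain.nil)
  next
    fix t assume a: "t \<in> T" "t + 1/2 \<in> T" "t1 \<le> t" "t + 1/2 \<le> t2"
      "\<exists>n. real n \<le> 2 * (t - t1) \<and> chain ?V n (b t1) (b t)"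
    then obtain n where n: "real n \<le> 2 * (t - t1)" "chain ?V n (b t1) (b t)" by blast
    show "\<exists>n. real n \<le> 2 * (t + 1/2 - t1) \<and> chain ?V n (b t1) (b (t + 1/2))"
      using ext[OF n(2) step_short[OF a(1,2)] a(2)] n(1) a(3,4) by (intro exI[of _ "Suc n"]) auto
  next
    fix t s assume a: "t \<in> T" "s \<in> S" "t1 \<le> t" "t \<le> s" "s < t + 1/2" "s + 1 \<le> t2"
      "\<exists>n. real n \<le> 2 * (t - t1) \<and> chain ?V n (b t1) (b t)"
    then obtain n where n: "real n \<le> 2 * (t - t1)" "chain ?V n (b t1) (b t)" by blast
    have "chain ?V (Suc n) (b t1) (b s)"
      by (rule ext[OF n(2) step_short]) (use a S_T in auto)
    then have "chain ?V (Suc (Suc n)) (b t1) (b (s + 1))"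
      by (rule ext[OF _ step_comp]) (use a S_T in auto)
    then show "\<exists>n. real n \<le> 2 * (s + 1 - t1) \<and> chain ?V n (b t1) (b (s + 1))"
      using n(1) a(4) by (intro exI[of _ "Suc (Suc n)"]) auto
  next
    fix t assume a: "t \<in> T" "t1 \<le> t" "t \<le> t2" "t2 < t + 1"
      "\<exists>n. real n \<le> 2 * (t - t1) \<and> chain ?V n (b t1) (b t)"
    then obtain n where n: "real n \<le> 2 * (t - t1)" "chain ?V n (b t1) (b t)" by blast
    define u where "u = (t + t2) / 2"
    have u: "u \<in> T" using T_interval[OF a(1) t(2) a(4), of u] a(3) by (auto simp: u_def)
    have "chain ?V (Suc n) (b t1) (b u)"
      by (rule ext[OF n(2) step_short]) (use a u in \<open>auto simp: u_def\<close>)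
    then have "chain ?V (Suc (Suc n)) (b t1) (b t2)"
      by (rule ext[OF _ step_short]) (use a u t in \<open>auto simp: u_def abs_if field_simps\<close>)
    then show ?thesis using n(1) a(3) by (intro exI[of _ "Suc (Suc n)"]) auto
  qed
qed

text \<open>Components in one \<open>P\<close> have all their endpoints in the same net, so a single
  edge would join points of \<gamma> at times more than \<open>1\<close> apart.\<close>

lemma component_sets_distinct:
  assumes "s \<in> S" "s' \<in> S" "s \<noteq> s'" "E P (b s) (b (s + 1))" "E P' (b s') (b (s' + 1))"
  shows "P \<noteq> P'"
proof -
  have *: "P \<noteq> P'" if "s \<in> S" "s' \<in> S" "s < s'" "E P (b s) (b (s + 1))" "E P' (b s') (b (s' + 1))" for s s' P P'
  proof
    assume "P = P'"
    then have "dh (b s) (b (s' + 1)) \<le> 1" using that dh_net[of P] by (auto simp: is_edge_def)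
    then show False using b_dh[of s "s' + 1"] S_T that(1-3) by auto
  qed
  show ?thesis using *[of s s' P P'] *[of s' s P' P] assms by (cases s s' rule: linorder_cases) auto
qed

lemma finite_S: "finite S"
proof -
  have "inj_on floor S"
  proof (rule inj_onI)
    fix s s' assume "s \<in> S" "s' \<in> S" "\<lfloor>s\<rfloor> = \<lfloor>s'\<rfloor>"
    then show "s = s'" using S_separated[of s s'] S_separated[of s' s] by linarith
  qed
  moreover have "floor ` S \<subseteq> {0..\<lfloor>L\<rfloor>}"
    using S_T(1) T_le by (fastforce intro: floor_mono)
  ultimately show ?thesis by (meson finite_atLeastAtMost_int finite_imageD finite_subset)
qed

end

context coned
begin

text \<open>Reversal turns the gain before a component into the gain after it.\<close>

lemma coned_geodesic_reverse:
  assumes "coned_geodesic \<P> N L \<gamma>"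
  shows "coned_geodesic \<P> N L (\<lambda>t. \<gamma> (L - t))"
proof -
  interpret coned_geodesic \<P> N L \<gamma> by fact
  show ?thesis
  proof
    show "geodesic_path (coned_off \<P> N) cd L (\<lambda>t. \<gamma> (L - t))"
      unfolding geodesic_path_def using L0 \<gamma>_mem \<gamma>_cd by auto
  qed (use ends in auto)
qed

lemma component_starts_reverse:
  assumes "s \<in> component_starts \<P> N L \<gamma>"
  shows "L - (s + 1) \<in> component_starts \<P> N L (\<lambda>t. \<gamma> (L - t))"
proof -
  obtain P x y where s: "0 \<le> s" "s + 1 \<le> L" "E P x y" "\<And>r. r \<in> {0..1} \<Longrightarrow> \<gamma> (s + r) = edge_point P x y r"
    using assms unfolding component_starts_def by blast
  have "\<gamma> (L - (L - (s + 1) + r)) = edge_point P y x r" if "r \<in> {0..1}" for r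
  proof -
    have "L - (L - (s + 1) + r) = s + (1 - r)" by simp
    then show ?thesis
      using s(4)[of "1 - r"] that edge_point_swap[OF E_neq[OF E_sym[OF s(3)]], of P r] by simp
  qed
  then show ?thesis using s E_sym[OF s(3)] unfolding component_starts_def by fastforce
qed

end

section \<open>Substituting components\<close>

context coned_geodesic
begin

text \<open>In comparison with \<open>T_induct\<close>, half steps, the move up to a component and
  the remainder are merged into moves shorter than \<open>1\<close>.\<close>

lemma T_induct_short:
  assumes t: "t1 \<in> T" "t2 \<in> T" "t1 \<le> t2" and init: "Q t1"
    and short: "\<And>t t'. t \<in> T \<Longrightarrow> t' \<in> T \<Longrightarrow> t1 \<le> t \<Longrightarrow> t \<le> t' \<Longrightarrow> t' < t + 1 \<Longrightarrow> t' \<le> t2 \<Longrightarrow> Q t \<Longrightarrow> Q t'"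
    and comp: "\<And>s. s \<in> S \<Longrightarrow> t1 \<le> s \<Longrightarrow> s + 1 \<le> t2 \<Longrightarrow> Q s \<Longrightarrow> Q (s + 1)"
  shows "Q t2"
proof (rule T_induct[OF t, of Q])
  show "Q t1" by fact
  show "Q (t + 1/2)" if "t \<in> T" "t + 1/2 \<in> T" "t1 \<le> t" "t + 1/2 \<le> t2" "Q t" for t
    using short[of t "t + 1/2"] that by simp
  show "Q (s + 1)" if "t \<in> T" "s \<in> S" "t1 \<le> t" "t \<le> s" "s < t + 1/2" "s + 1 \<le> t2" "Q t" for t s
  proof -
    have "Q s" using short[of t s] S_T(1) that by simp
    then show ?thesis using comp[of s] that by simp
  qed
  show "Q t2" if "t \<in> T" "t1 \<le> t" "t \<le> t2" "t2 < t + 1" "Q t" for t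
    using short[of t t2] t that by simp
qed

end

section \<open>The gain along one component\<close>

context rel_hyp_coned
begin

lemma component_gain:
  "\<exists>C. \<forall>L \<gamma> t0 s x p q. coned_geodesic \<P> N L \<gamma> \<longrightarrow> s \<in> component_starts \<P> N L \<gamma> \<longrightarrow>
     0 \<le> t0 \<longrightarrow> t0 \<le> s \<longrightarrow> \<gamma> t0 = Base x \<longrightarrow> \<gamma> s = Base p \<longrightarrow> \<gamma> (s + 1) = Base q \<longrightarrow>
     dist x p + dist p q \<le> dist x q + C"
proof -
  obtain H where H: "0 \<le> H" and morse: "\<And>(b :: real \<Rightarrow> 'a) T t1 t2 L g u. t1 \<in> T \<Longrightarrow> t2 \<in> T \<Longrightarrow>
     (\<forall>s\<in>T. \<forall>t\<in>T. dh (b s) (b t) = \<bar>s - t\<bar>) \<Longrightarrow>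
     (\<forall>s\<in>T. \<forall>t\<in>T. \<exists>n. real n \<le> 2 * \<bar>s - t\<bar> + 2 \<and> chain (b ` T) n (b s) (b t)) \<Longrightarrow>
     geod (b t1) (b t2) L g \<Longrightarrow> u \<in> {0..L} \<Longrightarrow> \<exists>t\<in>T. dh (g u) (b t) \<le> H"
    using geodesic_near_coned_geodesic by metis
  obtain c R where c: "0 \<le> c" and R: "\<And>P x y a b L g. P \<in> \<P> \<Longrightarrow> near_proj P 1 x a \<Longrightarrow>
      near_proj P 1 y b \<Longrightarrow> geod x y L g \<Longrightarrow> (\<forall>t\<in>{0..L}. g t \<notin> nbhd c P) \<Longrightarrow> dist a b \<le> R"
    using proj_contracting by metis
  obtain R2 where R2: "\<And>P Q u v a b. P \<in> \<P> \<Longrightarrow> Q \<in> \<P> \<Longrightarrow> P \<noteq> Q \<Longrightarrow> u \<in> Q \<Longrightarrow> v \<in> Q \<Longrightarrow>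
      near_proj P 1 u a \<Longrightarrow> near_proj P 1 v b \<Longrightarrow> dist a b \<le> R2"
    using proj_other_bounded by metis
  \<comment> \<open>If a geodesic from \<open>x\<close> to \<open>b t1\<close> entered
    \<open>nbhd c P\<close>, some \<open>b t'\<close> with \<open>t' \<le> t1\<close> would be
    within \<open>H + hP c\<close> of \<open>p\<close>; a time \<open>t1\<close> lying
    \<open>T0\<close> before \<open>s\<close> rules this out.\<close>
  define T0 where "T0 = H + hP c + 1"
  define c1 where "c1 = 3 + 2 * gc 0 1"
  \<comment> \<open>The speed at which almost nearest points in \<open>P\<close> move along
    \<gamma>: a half step costs at most \<open>c1\<close>, and a component at most \<open>R2\<close>
    besides the \<open>c1\<close> for the short move before it.\<close>
  define c2 where "c2 = 2 * (c1 + max R2 0)"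
  define C1 where "C1 = max R c1 + (c2 * (T0 + 1) + c1 + c1)"
  have hP0: "0 \<le> hP c" using c by (simp add: hP_def)
  have gc0: "0 \<le> gc 0 1" using qc_ge(3)[of 0] D0 \<sigma>0 B0 by (simp add: gc_def)
  have c0: "0 \<le> c1" "0 \<le> c2" using gc0 by (auto simp: c1_def c2_def)
  have lip: "dist a a' \<le> c1" if "P \<in> \<P>" "near_proj P 1 x a" "near_proj P 1 y a'" "dist x y \<le> 1" for P x y a a'
    using proj_lipschitz[OF that(1-3)] that(4) by (simp add: c1_def)
  have "dist x p + dist p q \<le> dist x q + (2 * C1 + 2 * gc 0 1)"
    if cg: "coned_geodesic \<P> N L \<gamma>" and s: "s \<in> component_starts \<P> N L \<gamma>"
      and t0: "0 \<le> t0" "t0 \<le> s" and xpq: "\<gamma> t0 = Base x" "\<gamma> s = Base p" "\<gamma> (s + 1) = Base q"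
    for L \<gamma> t0 s x p q
  proof -
    interpret coned_geodesic \<P> N L \<gamma> by fact
    have s: "s \<in> S" using s by (simp add: S_def)
    obtain P where P: "E P (b s) (b (s + 1))" and sT: "s \<in> T" "s + 1 \<in> T" by (rule S_component[OF s])
    have t0T: "t0 \<in> T" using t0 xpq T_le[OF sT(1)] by (auto simp: T_def)
    have b: "b t0 = x" "b s = p" "b (s + 1) = q"
      using Base_b[OF t0T] Base_b[OF sT(1)] Base_b[OF sT(2)] xpq by auto
    have PP: "P \<in> \<P>" "p \<in> P" "q \<in> P"
      using P net_subset by (auto simp: is_edge_def b)
    have np: "\<exists>a. near_proj P 1 y a" for y using near_proj_ex PP by blast
    \<comment> \<open>If \<open>s - T0\<close> falls inside a component, the start of that component
      is taken, which goes back by less than \<open>1\<close> more.\<close>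
    have "\<exists>t1\<in>T. t0 \<le> t1 \<and> t1 \<le> s \<and> s - t1 \<le> T0 + 1 \<and> (t1 = t0 \<or> T0 \<le> s - t1)"
    proof (cases "s - t0 \<le> T0 + 1")
      case True
      then show ?thesis using t0T t0 by blast
    next
      case False
      show ?thesis
      proof (cases "s - T0 \<in> T")
        case True
        then show ?thesis using False H hP0 by (intro bexI[of _ "s - T0"]) (auto simp: T0_def)
      next
        case nT: False
        have "s - T0 \<in> {0..L}" using False t0 T_le[OF sT(1)] H hP0 by (auto simp: T0_def)
        then obtain s' where "s' \<in> S" "s' < s - T0" "s - T0 < s' + 1"
          using not_T_component nT by blast
        then show ?thesis using False S_T(1) H hP0 by (intro bexI[of _ s']) (auto simp: T0_def)
      qed
    qed
    then obtain t1 where t1: "t1 \<in> T" "t0 \<le> t1" "t1 \<le> s" "s - t1 \<le> T0 + 1" "t1 = t0 \<or> T0 \<le> s - t1"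
      by blast
    obtain a where a: "near_proj P 1 x a" using np by blast
    obtain a' where a': "near_proj P 1 (b t1) a'" using np by blast
    have "\<forall>a''. near_proj P 1 (b s) a'' \<longrightarrow> dist a' a'' \<le> c2 * (s - t1) + c1 + c1"
    proof (rule T_induct[OF t1(1) sT(1) t1(3),
          of "\<lambda>t. \<forall>a''. near_proj P 1 (b t) a'' \<longrightarrow> dist a' a'' \<le> c2 * (t - t1) + c1"])
      show "\<forall>a''. near_proj P 1 (b t1) a'' \<longrightarrow> dist a' a'' \<le> c2 * (t1 - t1) + c1"
        using lip[OF PP(1) a'] by simp
    next
      fix t assume t: "t \<in> T" "t + 1/2 \<in> T"
        and IH: "\<forall>a''. near_proj P 1 (b t) a'' \<longrightarrow> dist a' a'' \<le> c2 * (t - t1) + c1"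
      show "\<forall>a''. near_proj P 1 (b (t + 1/2)) a'' \<longrightarrow> dist a' a'' \<le> c2 * (t + 1/2 - t1) + c1"
      proof (intro allI impI)
        fix z assume z: "near_proj P 1 (b (t + 1/2)) z"
        obtain y where y: "near_proj P 1 (b t) y" using np by blast
        have "dist y z \<le> c1" using lip[OF PP(1) y z] b_dist[OF t] by simp
        moreover have "c1 \<le> c2 * (1/2)" by (simp add: c2_def)
        moreover have "dist a' y \<le> c2 * (t - t1) + c1" using IH y by blast
        ultimately show "dist a' z \<le> c2 * (t + 1/2 - t1) + c1"
          using dist_triangle[of a' z y] by (simp add: algebra_simps)
      qed
    next
      fix t s' assume t: "t \<in> T" "s' \<in> S" "t1 \<le> t" "t \<le> s'" "s' < t + 1/2" "s' + 1 \<le> s"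
        and IH: "\<forall>a''. near_proj P 1 (b t) a'' \<longrightarrow> dist a' a'' \<le> c2 * (t - t1) + c1"
      obtain P' where P': "E P' (b s') (b (s' + 1))" by (rule S_component[OF t(2)])
      have neq: "P \<noteq> P'" using component_sets_distinct[OF s t(2) _ P P'] t(6) by auto
      have P'': "P' \<in> \<P>" "b s' \<in> P'" "b (s' + 1) \<in> P'"
        using P' net_subset by (auto simp: is_edge_def)
      show "\<forall>a''. near_proj P 1 (b (s' + 1)) a'' \<longrightarrow> dist a' a'' \<le> c2 * (s' + 1 - t1) + c1"
      proof (intro allI impI)
        fix z assume z: "near_proj P 1 (b (s' + 1)) z"
        obtain y where y: "near_proj P 1 (b t) y" using np by blast
        obtain y' where y': "near_proj P 1 (b s') y'" using np by blast
        have "dist y y' \<le> c1" using lip[OF PP(1) y y'] b_dist[of t s'] t S_T(1) by simp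
        moreover have "dist y' z \<le> R2" by (rule R2[OF PP(1) P''(1) neq P''(2,3) y' z])
        moreover have "dist a' y \<le> c2 * (t - t1) + c1" using IH y by blast
        ultimately have "dist a' z \<le> c2 * (t - t1) + c1 + (c1 + R2)"
          using dist_triangle[of a' z y] dist_triangle[of y z y'] by linarith
        also have "c1 + R2 \<le> c2" using c0 by (auto simp: c2_def)
        also have "c2 * (t - t1) + c1 + c2 = c2 * (t + 1 - t1) + c1" by (simp add: algebra_simps)
        also have "\<dots> \<le> c2 * (s' + 1 - t1) + c1" using t(4) c0 by (simp add: mult_left_mono)
        finally show "dist a' z \<le> c2 * (s' + 1 - t1) + c1" by simp
      qed
    next
      fix t assume t: "t \<in> T" "t1 \<le> t" "t \<le> s" "s < t + 1"
        and IH: "\<forall>a''. near_proj P 1 (b t) a'' \<longrightarrow> dist a' a'' \<le> c2 * (t - t1) + c1"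
      show "\<forall>a''. near_proj P 1 (b s) a'' \<longrightarrow> dist a' a'' \<le> c2 * (s - t1) + c1 + c1"
      proof (intro allI impI)
        fix z assume z: "near_proj P 1 (b s) z"
        obtain y where y: "near_proj P 1 (b t) y" using np by blast
        have "dist y z \<le> c1" using lip[OF PP(1) y z] b_dist[OF t(1) sT(1)] t by simp
        moreover have "dist a' y \<le> c2 * (t - t1) + c1" using IH y by blast
        moreover have "c2 * (t - t1) \<le> c2 * (s - t1)" using t c0 by (intro mult_left_mono) auto
        ultimately show "dist a' z \<le> c2 * (s - t1) + c1 + c1"
          using dist_triangle[of a' z y] by linarith
      qed
    qed
    moreover have "near_proj P 1 (b s) p" using PP by (simp add: near_proj_def b)
    moreover have "c2 * (s - t1) \<le> c2 * (T0 + 1)" using t1(4) c0 by (intro mult_left_mono) auto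
    ultimately have a'p: "dist a' p \<le> c2 * (T0 + 1) + c1 + c1" by fastforce
    have aa': "dist a a' \<le> max R c1"
    proof (cases "t1 = t0")
      case True
      then show ?thesis using lip[OF PP(1) a a'] b by simp
    next
      case False
      obtain Lg g where g: "geod x (b t1) Lg g" using geo by blast
      show ?thesis
      proof (rule ccontr)
        assume "\<not> ?thesis"
        then have "\<not> dist a a' \<le> R" by simp
        then obtain u where u: "u \<in> {0..Lg}" "g u \<in> nbhd c P"
          using R[OF PP(1) a a' g] by blast
        \<comment> \<open>Cutting at \<open>t1\<close> ensures that the point of \<gamma> found near
          \<open>g u\<close> comes no later than \<open>t1\<close>.\<close>
        let ?T = "T \<inter> {t0..t1}"
        have chains: "\<exists>n. real n \<le> 2 * \<bar>r - t\<bar> + 2 \<and> chain (b ` ?T) n (b r) (b t)"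
          if rt: "r \<in> ?T" "t \<in> ?T" for r t
        proof (cases "r \<le> t")
          case True
          then have "\<exists>n. real n \<le> 2 * (t - r) + 2 \<and> chain (b ` ?T) n (b r) (b t)"
            using rt by (intro chain_b) auto
          then show ?thesis using True by simp
        next
          case False
          then have "\<exists>n. real n \<le> 2 * (r - t) + 2 \<and> chain (b ` ?T) n (b t) (b r)"
            using rt by (intro chain_b) auto
          then show ?thesis using False chain_sym by fastforce
        qed
        have "\<exists>t\<in>?T. dh (g u) (b t) \<le> H"
          by (rule morse[of t0 _ t1 b Lg g]) (use t0T t1 b_dh chains g b u in auto)
        then obtain t' where t': "t' \<in> T" "t' \<le> t1" "dh (g u) (b t') \<le> H" by auto
        have "dh (g u) p \<le> hP c"
          using dh_nbhd[OF PP(1) u(2)] PP(2) c by (auto intro: nbhd_mem)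
        then have "dh (b t') (b s) \<le> H + hP c"
          using t'(3) dh_triangle[of "b t'" p "g u"] dh_commute[of "b t'" "g u"] b by simp
        then have "s - t' \<le> H + hP c" using b_dh[OF t'(1) sT(1)] by simp
        then show False using False t1(5) t'(2) by (simp add: T0_def)
      qed
    qed
    have ap: "dist a p \<le> C1"
      using aa' a'p dist_triangle[of a p a'] by (simp add: C1_def)
    have "dist x a + dist a q \<le> dist x q + 2 * gc 0 1"
      using proj_dist[OF PP(1) a, of q 0] PP(3) by (simp add: nbhd_mem)
    then show ?thesis
      using ap dist_triangle[of x p a] dist_triangle[of p q a] by (simp add: dist_commute)
  qed
  then show ?thesis by blast
qed

end

section \<open>Quasi-geodesicity of the substituted path\<close>

locale component_subst = coned_geodesic \<P> N L \<gamma>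
  for \<P> :: "'a::metric_space set set" and N L \<gamma> +
  fixes C :: real and len :: "real \<Rightarrow> real" and \<alpha> :: "real \<Rightarrow> real \<Rightarrow> 'a"
    and \<tau> :: "real \<Rightarrow> real" and \<eta> :: "real \<Rightarrow> 'a"
  assumes C0: "0 \<le> C"
    and gain_right: "\<And>t s. t \<in> T \<Longrightarrow> s \<in> S \<Longrightarrow> t \<le> s \<Longrightarrow>
      dist (b t) (b s) + dist (b s) (b (s + 1)) \<le> dist (b t) (b (s + 1)) + C"
    and gain_left: "\<And>t s. t \<in> T \<Longrightarrow> s \<in> S \<Longrightarrow> s + 1 \<le> t \<Longrightarrow>
      dist (b s) (b (s + 1)) + dist (b (s + 1)) (b t) \<le> dist (b s) (b t) + C"
    and \<tau>: "\<And>t. \<tau> t = t + (\<Sum>s | s \<in> S \<and> s + 1 \<le> t. len s - 1)"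
    and \<alpha>: "\<And>s. s \<in> S \<Longrightarrow> geod (b s) (b (s + 1)) (len s) (\<alpha> s)"
    and \<eta>_T: "\<And>t. t \<in> T \<Longrightarrow> \<eta> (\<tau> t) = b t"
    and \<eta>_S: "\<And>s r. s \<in> S \<Longrightarrow> r \<in> {0..len s} \<Longrightarrow> \<eta> (\<tau> s + r) = \<alpha> s r"
begin

lemma len: "s \<in> S \<Longrightarrow> len s = dist (b s) (b (s + 1))"
  using geodD(4)[OF \<alpha>] by simp

lemma \<tau>_0: "\<tau> 0 = 0"
proof -
  have none: "{s. s \<in> S \<and> s + 1 \<le> 0} = {}"
  proof -
    have "0 \<le> s" if "s \<in> S" for s using S_T(1)[OF that] T_le by auto
    then show ?thesis by force
  qed
  show ?thesis unfolding \<tau> none by simp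
qed

text \<open>No component ends between two times of \<open>T\<close> less than \<open>1\<close>
  apart, so the time shift is the same at both.\<close>

lemma \<tau>_short:
  assumes "t \<in> T" "t' \<in> T" "t \<le> t'" "t' < t + 1"
  shows "\<tau> t' = \<tau> t + (t' - t)"
proof -
  have "s + 1 \<le> t" if "s \<in> S" "s + 1 \<le> t'" for s
    using S_open[OF that(1), of t] assms that(2) by force
  then have "{s. s \<in> S \<and> s + 1 \<le> t'} = {s. s \<in> S \<and> s + 1 \<le> t}" using assms(3) by force
  then show ?thesis by (simp add: \<tau>)
qed

lemma \<tau>_comp:
  assumes "s \<in> S"
  shows "\<tau> (s + 1) = \<tau> s + len s"
proof -
  have "{r. r \<in> S \<and> r + 1 \<le> s + 1} = insert s {r. r \<in> S \<and> r + 1 \<le> s}"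
    using S_separated[OF _ assms] assms by (force simp: le_less)
  then show ?thesis using finite_S by (simp add: \<tau>)
qed

lemma \<tau>_upper:
  assumes t: "t1 \<in> T" "t2 \<in> T" "t1 \<le> t2"
  shows "dist (b t1) (b t2) \<le> \<tau> t2 - \<tau> t1"
proof (rule T_induct_short[OF t])
  fix t t' assume *: "t \<in> T" "t' \<in> T" "t \<le> t'" "t' < t + 1" "dist (b t1) (b t) \<le> \<tau> t - \<tau> t1"
  then show "dist (b t1) (b t') \<le> \<tau> t' - \<tau> t1"
    using \<tau>_short[OF *(1-4)] b_dist[OF *(1,2)] dist_triangle[of "b t1" "b t'" "b t"] by auto
next
  fix s assume "s \<in> S" "dist (b t1) (b s) \<le> \<tau> s - \<tau> t1"
  then show "dist (b t1) (b (s + 1)) \<le> \<tau> (s + 1) - \<tau> t1"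
    using \<tau>_comp[of s] len[of s] dist_triangle[of "b t1" "b (s + 1)" "b s"] by auto
qed simp

lemma \<tau>_mono: "t1 \<in> T \<Longrightarrow> t2 \<in> T \<Longrightarrow> t1 \<le> t2 \<Longrightarrow> \<tau> t1 \<le> \<tau> t2"
  using \<tau>_upper[of t1 t2] zero_le_dist[of "b t1" "b t2"] by linarith

text \<open>Along a component the distance to \<open>b t1\<close> grows by its length up to \<open>C\<close>, and elsewhere it drops
  at most at unit speed; the total loss is paid for by \<open>t2 - t1 = dh (b t1) (b t2)\<close>.\<close>

lemma \<tau>_lower:
  assumes t: "t1 \<in> T" "t2 \<in> T" "t1 \<le> t2"
  shows "\<tau> t2 - \<tau> t1 \<le> (3 + C) * dist (b t1) (b t2)"
proof -
  have "\<tau> t2 - \<tau> t1 \<le> dist (b t1) (b t2) + (2 + C) * (t2 - t1)"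
  proof (rule T_induct_short[OF t])
    fix t t' assume *: "t \<in> T" "t' \<in> T" "t \<le> t'" "t' < t + 1"
      "\<tau> t - \<tau> t1 \<le> dist (b t1) (b t) + (2 + C) * (t - t1)"
    have "dist (b t1) (b t) \<le> dist (b t1) (b t') + (t' - t)"
      using b_dist[OF *(1,2)] dist_triangle[of "b t1" "b t" "b t'"] *(3,4) by (simp add: dist_commute)
    moreover have "0 \<le> C * (t' - t)" using C0 *(3) by simp
    ultimately show "\<tau> t' - \<tau> t1 \<le> dist (b t1) (b t') + (2 + C) * (t' - t1)"
      using \<tau>_short[OF *(1-4)] *(5) by (simp add: algebra_simps)
  next
    fix s assume *: "s \<in> S" "t1 \<le> s" "\<tau> s - \<tau> t1 \<le> dist (b t1) (b s) + (2 + C) * (s - t1)"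
    then show "\<tau> (s + 1) - \<tau> t1 \<le> dist (b t1) (b (s + 1)) + (2 + C) * (s + 1 - t1)"
      using \<tau>_comp[OF *(1)] len[OF *(1)] gain_right[OF t(1) *(1,2)] by (simp add: algebra_simps)
  qed simp
  also have "(2 + C) * (t2 - t1) \<le> (2 + C) * dist (b t1) (b t2)"
    using b_dh[OF t(1,2)] dh_le_dist[of "b t1" "b t2"] t(3) C0 by (intro mult_left_mono) auto
  finally show ?thesis by (simp add: algebra_simps)
qed

text \<open>Treats all times of the substituted path alike: \<open>\<eta> u\<close> lies on a
  geodesic of X from \<open>b l\<close> to \<open>b r\<close>, either a substituted one or, for
  \<open>l = r\<close>, a single point.\<close>

definition anchored :: "real \<Rightarrow> real \<Rightarrow> real \<Rightarrow> bool" where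
  "anchored u l r \<longleftrightarrow> (l \<in> T \<and> r = l \<or> l \<in> S \<and> r = l + 1) \<and> \<tau> l \<le> u \<and> u \<le> \<tau> r \<and>
     dist (b l) (\<eta> u) = u - \<tau> l \<and> dist (\<eta> u) (b r) = \<tau> r - u \<and> dist (b l) (b r) = \<tau> r - \<tau> l"

lemma anchored_T: "t \<in> T \<Longrightarrow> anchored (\<tau> t) t t"
  by (simp add: anchored_def \<eta>_T)

lemma anchored_S:
  assumes "s \<in> S" "\<tau> s \<le> u" "u \<le> \<tau> (s + 1)"
  shows "anchored u s (s + 1)"
proof -
  have u: "u - \<tau> s \<in> {0..len s}" using assms \<tau>_comp[OF assms(1)] by simp
  have "\<eta> u = \<alpha> s (u - \<tau> s)" using \<eta>_S[OF assms(1) u] by simp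
  then show ?thesis
    unfolding anchored_def
    using assms geodD(6,7)[OF \<alpha>[OF assms(1)] u] len[OF assms(1)] \<tau>_comp[OF assms(1)] by simp
qed

text \<open>On stretches inside \<open>T\<close> the map \<tau> is a translation, and over a
  component it jumps by \<open>len s\<close>; so base times and substituted geodesics together fill
  \<open>{0..\<tau> L}\<close>.\<close>

lemma anchored_ex:
  assumes "0 \<le> u" "u \<le> \<tau> L"
  shows "\<exists>l r. anchored u l r"
proof -
  have "\<forall>u. 0 \<le> u \<longrightarrow> u \<le> \<tau> L \<longrightarrow> (\<exists>l r. anchored u l r)"
  proof (rule T_induct_short[OF T_ends L0, of "\<lambda>t. \<forall>u\<ge>0. u \<le> \<tau> t \<longrightarrow> (\<exists>l r. anchored u l r)"])
    show "\<forall>u\<ge>0. u \<le> \<tau> 0 \<longrightarrow> (\<exists>l r. anchored u l r)"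
    proof (intro allI impI)
      fix u assume "0 \<le> u" "u \<le> \<tau> 0"
      then have "u = \<tau> 0" using \<tau>_0 by simp
      then show "\<exists>l r. anchored u l r" using anchored_T[OF T_ends(1)] by blast
    qed
  next
    fix t t' assume *: "t \<in> T" "t' \<in> T" "t \<le> t'" "t' < t + 1"
      "\<forall>u\<ge>0. u \<le> \<tau> t \<longrightarrow> (\<exists>l r. anchored u l r)"
    show "\<forall>u\<ge>0. u \<le> \<tau> t' \<longrightarrow> (\<exists>l r. anchored u l r)"
    proof (intro allI impI)
      fix u assume u: "0 \<le> u" "u \<le> \<tau> t'"
      show "\<exists>l r. anchored u l r"
      proof (cases "u \<le> \<tau> t")
        case True
        then show ?thesis using * u by blast
      next
        case False
        define v where "v = t + (u - \<tau> t)"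
        have v: "t \<le> v" "v \<le> t'" using False u(2) \<tau>_short[OF *(1-4)] by (auto simp: v_def)
        then have vT: "v \<in> T" using T_interval[OF *(1,2,4)] by blast
        then have "\<tau> v = u" using \<tau>_short[OF *(1) vT] v *(4) by (simp add: v_def)
        then show ?thesis using anchored_T[OF vT] by auto
      qed
    qed
  next
    fix s assume *: "s \<in> S" "\<forall>u\<ge>0. u \<le> \<tau> s \<longrightarrow> (\<exists>l r. anchored u l r)"
    show "\<forall>u\<ge>0. u \<le> \<tau> (s + 1) \<longrightarrow> (\<exists>l r. anchored u l r)"
    proof (intro allI impI)
      fix u assume u: "0 \<le> u" "u \<le> \<tau> (s + 1)"
      show "\<exists>l r. anchored u l r"
      proof (cases "u \<le> \<tau> s")
        case True
        then show ?thesis using *(2) u by blast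
      next
        case False
        then show ?thesis using anchored_S[OF *(1) _ u(2)] by auto
      qed
    qed
  qed
  then show ?thesis using assms by blast
qed

lemma anchored_mem: "anchored u l r \<Longrightarrow> l \<in> T \<and> r \<in> T \<and> l \<le> r"
  using S_T by (auto simp: anchored_def)

text \<open>By monotonicity of \<tau> on \<open>T\<close>, the intervals from \<open>l\<close> to
  \<open>r\<close> and from \<open>l'\<close> to \<open>r'\<close> follow the order of
  \<open>u\<close> and \<open>u'\<close>; no base time lies inside a component, so they can overlap
  only within a common one.\<close>

lemma anchored_order:
  assumes u: "anchored u l r" and u': "anchored u' l' r'" and "u < u'"
  shows "r \<le> l' \<or> l \<in> S \<and> l' = l"
proof (rule ccontr)
  assume *: "\<not> ?thesis"
  have "\<not> r' \<le> l"
  proof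
    assume "r' \<le> l"
    then have "\<tau> r' \<le> \<tau> l" using \<tau>_mono anchored_mem[OF u] anchored_mem[OF u'] by blast
    then show False using assms by (simp add: anchored_def)
  qed
  moreover have dich: "x + 1 \<le> y \<or> y \<le> x" if "x \<in> S" "y \<in> T" for x y
    using S_open[OF that(1), of y] that(2) by force
  have T: "l \<in> T" "l' \<in> T" using anchored_mem[OF u] anchored_mem[OF u'] by auto
  have "l \<in> S \<and> r = l + 1 \<or> r = l" using u by (auto simp: anchored_def)
  then have "l' < l" using * dich[of l l'] T by auto
  moreover have "l' \<in> S \<and> r' = l' + 1 \<or> r' = l'" using u' by (auto simp: anchored_def)
  ultimately show False using dich[of l' l] T by auto
qed

lemma anchored_bounds:
  assumes u: "anchored u l r" and u': "anchored u' l' r'" and "u < u'"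
  shows "dist (\<eta> u) (\<eta> u') \<le> u' - u" "u' - u \<le> (3 + C) * (dist (\<eta> u) (\<eta> u') + 2 * C)"
proof -
  have T: "l \<in> T" "r \<in> T" "l \<le> r" "l' \<in> T" "r' \<in> T" "l' \<le> r'"
    using anchored_mem[OF u] anchored_mem[OF u'] by auto
  have \<tau>u: "\<tau> l \<le> u" "u \<le> \<tau> r" "dist (b l) (\<eta> u) = u - \<tau> l" "dist (\<eta> u) (b r) = \<tau> r - u"
      "dist (b l) (b r) = \<tau> r - \<tau> l"
    and \<tau>u': "\<tau> l' \<le> u'" "u' \<le> \<tau> r'" "dist (b l') (\<eta> u') = u' - \<tau> l'" "dist (\<eta> u') (b r') = \<tau> r' - u'"
      "dist (b l') (b r') = \<tau> r' - \<tau> l'"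
    using u u' by (auto simp: anchored_def)
  have "dist (\<eta> u) (\<eta> u') \<le> u' - u \<and> u' - u \<le> (3 + C) * (dist (\<eta> u) (\<eta> u') + 2 * C)"
    using anchored_order[OF assms]
  proof
    assume le: "r \<le> l'"
    have 1: "dist (\<eta> u) (\<eta> u') \<le> u' - u"
      using \<tau>u \<tau>u' \<tau>_upper[OF T(2,4) le] dist_triangle[of "\<eta> u" "\<eta> u'" "b r"]
        dist_triangle[of "b r" "\<eta> u'" "b l'"] by linarith
    \<comment> \<open>The gain on the left splits off the first geodesic and the gain on the right
      the last one. Together they show that passing through \<open>b r\<close> and
      \<open>b l'\<close> lengthens the way by at most \<open>2 * C\<close>.\<close>
    have "dist (b l) (b r) + dist (b r) (b l') \<le> dist (b l) (b l') + C"
      using u gain_left[OF T(4), of l] le C0 by (auto simp: anchored_def)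
    moreover have "dist (b l) (b l') + dist (b l') (b r') \<le> dist (b l) (b r') + C"
      using u' gain_right[OF T(1), of l'] le T C0 by (auto simp: anchored_def)
    moreover have "dist (b l) (b r') \<le> (u - \<tau> l) + dist (\<eta> u) (\<eta> u') + (\<tau> r' - u')"
      using \<tau>u \<tau>u' dist_triangle[of "b l" "b r'" "\<eta> u"] dist_triangle[of "\<eta> u" "b r'" "\<eta> u'"] by linarith
    ultimately have 2: "(\<tau> r - u) + dist (b r) (b l') + (u' - \<tau> l') \<le> dist (\<eta> u) (\<eta> u') + 2 * C"
      using \<tau>u(5) \<tau>u'(5) by linarith
    have "u' - u = (\<tau> r - u) + (\<tau> l' - \<tau> r) + (u' - \<tau> l')" by simp
    also have "\<dots> \<le> (3 + C) * (\<tau> r - u) + (3 + C) * dist (b r) (b l') + (3 + C) * (u' - \<tau> l')"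
    proof -
      have "x \<le> (3 + C) * x" if "0 \<le> x" for x
        using mult_right_mono[of 1 "3 + C" x] C0 that by simp
      then show ?thesis using \<tau>_lower[OF T(2,4) le] \<tau>u(2) \<tau>u'(1) by (intro add_mono) auto
    qed
    also have "\<dots> = (3 + C) * ((\<tau> r - u) + dist (b r) (b l') + (u' - \<tau> l'))"
      by (simp add: algebra_simps)
    also have "\<dots> \<le> (3 + C) * (dist (\<eta> u) (\<eta> u') + 2 * C)"
      using 2 C0 by (intro mult_left_mono) auto
    finally show ?thesis using 1 by blast
  next
    assume l: "l \<in> S \<and> l' = l"
    have in_len: "v - \<tau> l \<in> {0..len l} \<and> \<eta> v = \<alpha> l (v - \<tau> l)" if "\<tau> l \<le> v" "v \<le> \<tau> (l + 1)" for v
      using that l \<eta>_S[of l "v - \<tau> l"] \<tau>_comp[of l] by auto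
    have "\<tau> r \<le> \<tau> (l + 1)" "\<tau> r' \<le> \<tau> (l + 1)"
      using u u' l \<tau>_mono[of l "l + 1"] S_T by (auto simp: anchored_def)
    then have "dist (\<eta> u) (\<eta> u') = u' - u"
      using in_len[of u] in_len[of u'] \<tau>u(1,2) \<tau>u'(1,2) l
        geodD(5)[OF \<alpha>[of l], of "u - \<tau> l" "u' - \<tau> l"] assms(3) by auto
    moreover have "1 * (u' - u) \<le> (3 + C) * (u' - u + 2 * C)"
      using C0 assms(3) by (intro mult_mono) auto
    ultimately show ?thesis by simp
  qed
  then show "dist (\<eta> u) (\<eta> u') \<le> u' - u" "u' - u \<le> (3 + C) * (dist (\<eta> u) (\<eta> u') + 2 * C)" by blast+
qed

text \<open>One constant has to majorise both the factor \<open>3 + C\<close> and the additive error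
  \<open>2 * C\<close>.\<close>

lemma quasi_geodesic_substitution: "quasi_geodesic (3 + 3 * C) (3 + 3 * C) (\<tau> L) \<eta>"
proof -
  let ?K = "3 + 3 * C"
  have *: "\<bar>u - u'\<bar> / ?K - ?K \<le> dist (\<eta> u) (\<eta> u') \<and> dist (\<eta> u) (\<eta> u') \<le> ?K * \<bar>u - u'\<bar> + ?K"
    if "u \<in> {0..\<tau> L}" "u' \<in> {0..\<tau> L}" "u \<le> u'" for u u'
  proof (cases "u = u'")
    case False
    then have lt: "u < u'" using that by simp
    obtain l r where u: "anchored u l r" using anchored_ex[of u] \<open>u \<in> {0..\<tau> L}\<close> by auto
    obtain l' r' where u': "anchored u' l' r'" using anchored_ex[of u'] \<open>u' \<in> {0..\<tau> L}\<close> by auto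
    from anchored_bounds[OF u u' lt] have b: "dist (\<eta> u) (\<eta> u') \<le> u' - u"
      "u' - u \<le> (3 + C) * (dist (\<eta> u) (\<eta> u') + 2 * C)" .
    have "(u' - u) / ?K \<le> (u' - u) / (3 + C)"
      using lt C0 by (intro divide_left_mono) auto
    also have "\<dots> \<le> dist (\<eta> u) (\<eta> u') + 2 * C"
      using b(2) C0 by (simp add: divide_le_eq mult.commute)
    finally have "\<bar>u - u'\<bar> / ?K - ?K \<le> dist (\<eta> u) (\<eta> u')" using lt C0 by simp
    moreover have "dist (\<eta> u) (\<eta> u') \<le> ?K * \<bar>u - u'\<bar> + ?K"
    proof -
      have "dist (\<eta> u) (\<eta> u') \<le> 1 * \<bar>u - u'\<bar>" using b(1) lt by simp
      also have "\<dots> \<le> ?K * \<bar>u - u'\<bar>" using C0 by (intro mult_right_mono) auto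
      also have "\<dots> \<le> ?K * \<bar>u - u'\<bar> + ?K" using C0 by simp
      finally show ?thesis .
    qed
    ultimately show ?thesis by blast
  qed (use C0 in auto)
  have "\<bar>u - u'\<bar> / ?K - ?K \<le> dist (\<eta> u) (\<eta> u') \<and> dist (\<eta> u) (\<eta> u') \<le> ?K * \<bar>u - u'\<bar> + ?K"
    if "u \<in> {0..\<tau> L}" "u' \<in> {0..\<tau> L}" for u u'
    using *[of u u'] *[of u' u] that by (cases "u \<le> u'") (simp_all add: dist_commute abs_minus_commute)
  moreover have "0 \<le> \<tau> L" using \<tau>_mono[OF T_ends L0] \<tau>_0 by simp
  ultimately show ?thesis unfolding quasi_geodesic_def using C0 by auto
qed

end

lemma (in rel_hyp_coned) substitution_quasi_geodesic:
  "\<exists>K. \<forall>L \<gamma> L' \<eta>. coned_geodesic \<P> N L \<gamma> \<longrightarrow> component_substitution \<P> N L \<gamma> L' \<eta> \<longrightarrow>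
     quasi_geodesic K K L' \<eta>"
proof -
  obtain C where C: "\<And>L \<gamma> t s x p q. \<lbrakk>coned_geodesic \<P> N L \<gamma>; s \<in> component_starts \<P> N L \<gamma>;
     0 \<le> t; t \<le> s; \<gamma> t = Base x; \<gamma> s = Base p; \<gamma> (s + 1) = Base q\<rbrakk> \<Longrightarrow>
     dist x p + dist p q \<le> dist x q + C"
    using component_gain by metis
  let ?C = "max C 0"
  have "quasi_geodesic (3 + 3 * ?C) (3 + 3 * ?C) L' \<eta>"
    if cg: "coned_geodesic \<P> N L \<gamma>" and sub: "component_substitution \<P> N L \<gamma> L' \<eta>" for L \<gamma> L' \<eta>
  proof -
    interpret coned_geodesic \<P> N L \<gamma> by fact
    obtain len \<alpha> where \<alpha>: "\<And>s. s \<in> S \<Longrightarrow> geodesic_path UNIV dist (len s) (\<alpha> s)"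
        "\<And>s. s \<in> S \<Longrightarrow> Base (\<alpha> s 0) = \<gamma> s" "\<And>s. s \<in> S \<Longrightarrow> Base (\<alpha> s (len s)) = \<gamma> (s + 1)"
      and L': "L' = L + (\<Sum>s | s \<in> S \<and> s + 1 \<le> L. len s - 1)"
      and \<eta>: "\<And>t. t \<in> {0..L} \<Longrightarrow> (\<forall>s\<in>S. t \<notin> {s<..<s + 1}) \<Longrightarrow>
          Base (\<eta> (t + (\<Sum>s | s \<in> S \<and> s + 1 \<le> t. len s - 1))) = \<gamma> t"
        "\<And>s r. s \<in> S \<Longrightarrow> r \<in> {0..len s} \<Longrightarrow>
          \<eta> (s + (\<Sum>s' | s' \<in> S \<and> s' + 1 \<le> s. len s' - 1) + r) = \<alpha> s r"
      using sub unfolding component_substitution_def Let_def S_def[symmetric] by blast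
    have "component_subst \<P> N L \<gamma> ?C len \<alpha>
      (\<lambda>t. t + (\<Sum>s | s \<in> S \<and> s + 1 \<le> t. len s - 1)) \<eta>"
    proof (intro component_subst.intro component_subst_axioms.intro)
      fix t s assume t: "t \<in> T" and s: "s \<in> S" and le: "t \<le> s"
      show "dist (b t) (b s) + dist (b s) (b (s + 1)) \<le> dist (b t) (b (s + 1)) + ?C"
        using C[OF cg, of s t "b t" "b s" "b (s + 1)"] s le t T_le[OF t] Base_b S_T by (simp add: S_def)
    next
      fix t s assume t: "t \<in> T" and s: "s \<in> S" and le: "s + 1 \<le> t"
      \<comment> \<open>In the reversed geodesic \<open>b t\<close> comes before the component,
        which starts at time \<open>L - (s + 1)\<close> and runs from \<open>b (s + 1)\<close> to
        \<open>b s\<close>.\<close>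
      have "dist (b t) (b (s + 1)) + dist (b (s + 1)) (b s) \<le> dist (b t) (b s) + C"
        using C[OF coned_geodesic_reverse[OF cg] component_starts_reverse, of s "L - t"
            "b t" "b (s + 1)" "b s"] s le t T_le[OF t] Base_b S_T by (simp add: S_def)
      then show "dist (b s) (b (s + 1)) + dist (b (s + 1)) (b t) \<le> dist (b s) (b t) + ?C"
        by (simp add: dist_commute)
    next
      fix s assume s: "s \<in> S"
      have "Base (\<alpha> s 0) = Base (b s)" "Base (\<alpha> s (len s)) = Base (b (s + 1))"
        using \<alpha>(2,3)[OF s] Base_b S_T s by simp_all
      then show "geod (b s) (b (s + 1)) (len s) (\<alpha> s)"
        using \<alpha>(1)[OF s] by (simp add: geodesic_from_to_def)
    next
      fix t assume t: "t \<in> T"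
      have "\<forall>s\<in>S. t \<notin> {s<..<s + 1}" using S_open t by auto
      then have "Base (\<eta> (t + (\<Sum>s | s \<in> S \<and> s + 1 \<le> t. len s - 1))) = Base (b t)"
        using \<eta>(1) T_le[OF t] Base_b[OF t] by simp
      then show "\<eta> (t + (\<Sum>s | s \<in> S \<and> s + 1 \<le> t. len s - 1)) = b t" by simp
    qed (use cg \<eta>(2) in auto)
    then show ?thesis unfolding L' by (rule component_subst.quasi_geodesic_substitution)
  qed
  then show ?thesis by blast
qed

theorem corollary4p12:
  fixes \<P> :: "'a::metric_space set set"
    and N :: "'a set \<Rightarrow> 'a set"
    and k :: real
  assumes "geodesic_space (UNIV :: 'a set) dist"
    and "relatively_hyperbolic \<P>"
    and "uniformly_coarsely_connected \<P>"
    and "\<And>P. P \<in> \<P> \<Longrightarrow> maximal_net k P (N P)"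
  shows "\<exists>K. \<forall>L \<gamma> L' \<eta>.
    geodesic_path (coned_off \<P> N) (coned_dist \<P> N) L \<gamma> \<longrightarrow>
    \<gamma> 0 \<in> range Base \<longrightarrow> \<gamma> L \<in> range Base \<longrightarrow>
    component_substitution \<P> N L \<gamma> L' \<eta> \<longrightarrow>
    quasi_geodesic K K L' \<eta>"
proof -
  obtain B where B: "\<And>P Q K x y. \<lbrakk>P \<in> \<P>; Q \<in> \<P>; P \<noteq> Q; x \<in> nbhd K P; x \<in> nbhd K Q;
      y \<in> nbhd K P; y \<in> nbhd K Q\<rbrakk> \<Longrightarrow> dist x y \<le> B K"
    using assms(2) unfolding relatively_hyperbolic_def alpha1_def by (metis IntI)
  obtain \<epsilon> M where \<epsilon>: "0 < \<epsilon>" "0 \<le> M" and a2: "\<And>P x y L g. \<lbrakk>P \<in> \<P>; x \<in> nbhd (\<epsilon> * dist x y) P;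
      y \<in> nbhd (\<epsilon> * dist x y) P; geodesic_from_to UNIV dist x y L g\<rbrakk> \<Longrightarrow> g ` {0..L} \<inter> nbhd M P \<noteq> {}"
    using assms(2) unfolding relatively_hyperbolic_def alpha2_def by metis
  \<comment> \<open>The instance \<open>C = 0\<close> governs triangles with geodesic sides.\<close>
  obtain \<sigma> \<delta> where tri: "\<And>L g. almost_geodesic_triangle 0 L g \<Longrightarrow>
      triangle_cond_C \<sigma> L g \<or> triangle_cond_P \<P> \<sigma> \<delta> L g"
    using assms(2) unfolding relatively_hyperbolic_def star_asymp_tree_graded_def by (meson order_refl)
  \<comment> \<open>The bound from \<open>alpha1\<close> may be negative where it is vacuous, hence
    the maximum with \<open>0\<close>.\<close>
  interpret rel_hyp_coned \<P> \<epsilon> M \<sigma> \<delta> "\<lambda>K. max (B K) 0" N k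
  proof
    show "\<exists>L g. geodesic_from_to UNIV dist x y L g" for x y :: 'a
      using assms(1) by (simp add: geodesic_space_def)
    show "dist x y \<le> max (B K) 0" if "P \<in> \<P>" "Q \<in> \<P>" "P \<noteq> Q" "x \<in> nbhd K P" "x \<in> nbhd K Q"
      "y \<in> nbhd K P" "y \<in> nbhd K Q" for P Q K x y
      using B[OF that] by simp
  qed (use \<epsilon> a2 tri assms(4) in auto)
  show ?thesis
    using substitution_quasi_geodesic unfolding coned_geodesic_def by meson
qed

end
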